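(* Let $n,m\ge2$ be integers, and in $\mathcal O_{n,m}$ let $S=\frac1{\sqrt n}\sum_{i=1}^n s_i$, $T=\frac1{\sqrt m}\sum_{j=1}^m t_j$ and $R=ST^*$, which is a partial isometry. Then $R$ is not a power partial isometry. More precisely, $R^2$ is not a partial isometry.
   Context: **The algebra $\mathcal O_{n,m}$.** For integers $n,m\ge1$, $L_{n,m}$ is the universal unital C*-algebra generated by partial isometries $s_1,\dots,s_n,t_1,\dots,t_m$ subject to: $s_i^*s_k=0$ for $i\ne k$; $t_j^*t_l=0$ for $j\neq l$; $s_i^*s_i=t_j^*t_j=:q$ for all $i,j$; $\sum_{i=1}^n s_is_i^*=\sum_{j=1}^m t_jt_j^*=:p$; $pq=0$, $p+q=1$. Let $J$ be the closed two-sided ideal of $L_{n,m}$ generated by all $xx^*x-x$, with $x$ in the multiplicative semigroup generated by the $s_i,s_i^*,t_j,t_j^*$, and put $\mathcal O_{n,m}=L_{n,m}/J$. The images of $s_i,t_j$ in $\mathcal O_{n,m}$ are denoted by the same symbols. A power partial isometry is a partial isometry all of whose powers are partial isometries. *)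

theory Defs
  imports "HOL-Algebra.QuotRing" "HOL-Algebra.Module" "HOL-Library.Poly_Mapping" Complex_Main
begin

section \<open>Normed star-algebras with carriers\<close>

text \<open>
  A complex star-algebra is a HOL-Algebra ring with a scalar multiplication and an adjoint
  operation; a normed one carries in addition a real-valued (semi)norm.
\<close>

record 'a star_algebra = "(complex, 'a) module" +
  adj :: "'a \<Rightarrow> 'a"

record 'a normed_star_algebra = "'a star_algebra" +
  cnorm :: "'a \<Rightarrow> real"

definition partial_isometry :: "('a, 'b) star_algebra_scheme \<Rightarrow> 'a \<Rightarrow> bool" where
  "partial_isometry A x \<longleftrightarrow>
     x \<in> carrier A \<and> x \<otimes>\<^bsub>A\<^esub> adj A x \<otimes>\<^bsub>A\<^esub> x = x"

definition power_partial_isometry :: "('a, 'b) star_algebra_scheme \<Rightarrow> 'a \<Rightarrow> bool" where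
  "power_partial_isometry A x \<longleftrightarrow>
     partial_isometry A x \<and> (\<forall>k::nat. k \<ge> 1 \<longrightarrow> partial_isometry A (x [^]\<^bsub>A\<^esub> k))"

definition closed_in_norm :: "('a, 'b) normed_star_algebra_scheme \<Rightarrow> 'a set \<Rightarrow> bool" where
  "closed_in_norm A I \<longleftrightarrow>
     (\<forall>x\<in>carrier A. (\<forall>e>0. \<exists>y\<in>I. cnorm A (x \<ominus>\<^bsub>A\<^esub> y) < e) \<longrightarrow> x \<in> I)"

definition closed_ideal_gen :: "('a, 'b) normed_star_algebra_scheme \<Rightarrow> 'a set \<Rightarrow> 'a set" where
  "closed_ideal_gen A X = \<Inter> {I. ideal I A \<and> closed_in_norm A I \<and> X \<subseteq> I}"

text \<open>
  The quotient by a two-sided, self-adjoint ideal \<open>I\<close>: the ring part is the library's factor ring,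
  scalar multiplication and adjoint are applied to representatives, and the norm is the quotient
  norm, i.e. the distance to \<open>I\<close>.
\<close>

definition quot_algebra ::
  "('a, 'b) normed_star_algebra_scheme \<Rightarrow> 'a set \<Rightarrow> 'a set normed_star_algebra" where
  "quot_algebra A I =
     \<lparr>carrier = carrier (A Quot I), mult = mult (A Quot I), one = one (A Quot I),
      zero = zero (A Quot I), add = add (A Quot I),
      smult = (\<lambda>c U. \<Union>u\<in>U. I +>\<^bsub>A\<^esub> (c \<odot>\<^bsub>A\<^esub> u)),
      adj = (\<lambda>U. \<Union>u\<in>U. I +>\<^bsub>A\<^esub> adj A u),
      cnorm = (\<lambda>U. INF u\<in>U. cnorm A u)\<rparr>"

inductive_set semigroup_gen :: "('a, 'b) monoid_scheme \<Rightarrow> 'a set \<Rightarrow> 'a set"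
  for A :: "('a, 'b) monoid_scheme" and X :: "'a set" where
  incl: "x \<in> X \<Longrightarrow> x \<in> semigroup_gen A X"
| prod: "x \<in> semigroup_gen A X \<Longrightarrow> y \<in> semigroup_gen A X \<Longrightarrow> x \<otimes>\<^bsub>A\<^esub> y \<in> semigroup_gen A X"


section \<open>The free unital star-algebra\<close>

text \<open>
  The free unital complex star-algebra on a set is the monoid algebra of the free monoid on the
  disjoint union of two copies of the set.  A letter is a generator together with a flag saying
  whether it is starred.  The monoid is written additively, so that \<open>'g word \<Rightarrow>\<^sub>0 complex\<close>
  with the convolution product of the library is its monoid algebra.
\<close>

datatype 'g word = Word (letters: "('g \<times> bool) list")

instantiation word :: (type) monoid_add
begin
definition zero_word :: "'a word" where "0 = Word []"
definition plus_word :: "'a word \<Rightarrow> 'a word \<Rightarrow> 'a word" where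
  "u + v = Word (letters u @ letters v)"
instance by standard (simp_all add: zero_word_def plus_word_def)
end

definition word_adj :: "'g word \<Rightarrow> 'g word" where
  "word_adj w = Word (rev (map (\<lambda>(g, b). (g, \<not> b)) (letters w)))"

type_synonym 'g free_alg = "'g word \<Rightarrow>\<^sub>0 complex"

definition free_gen :: "'g \<Rightarrow> 'g free_alg" where
  "free_gen g = Poly_Mapping.single (Word [(g, False)]) 1"

definition free_adj :: "'g free_alg \<Rightarrow> 'g free_alg" where
  "free_adj a = (\<Sum>w\<in>Poly_Mapping.keys a. Poly_Mapping.single (word_adj w) (cnj (Poly_Mapping.lookup a w)))"

definition free_star_algebra :: "'g set \<Rightarrow> 'g free_alg star_algebra" where
  "free_star_algebra G =
     \<lparr>carrier = {a. \<forall>w\<in>Poly_Mapping.keys a. fst ` set (letters w) \<subseteq> G},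
      mult = (*), one = 1, zero = 0, add = (+),
      smult = (\<lambda>c a. Poly_Mapping.single 0 c * a), adj = free_adj\<rparr>"


section \<open>Universal C*-algebras\<close>

text \<open>
  The universal unital C*-algebra on generators \<open>G\<close> and relations \<open>r = 0\<close>, \<open>r \<in> Rel\<close>, is the
  separation and completion of the free star-algebra with respect to the largest C*-seminorm that
  vanishes on \<open>Rel\<close>.  (C*-seminorms vanishing on \<open>Rel\<close> are precisely the functions
  \<open>a \<mapsto> \<parallel>\<pi>(a)\<parallel>\<close>, where \<open>\<pi>\<close> is a star-homomorphism into a C*-algebra that respects the
  relations.)  The supremum is meaningful only if these seminorms are pointwise bounded; for the
  relations of \<open>L\<^sub>n\<^sub>,\<^sub>m\<close> this is \<open>L_seminorms_bdd\<close> below.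
\<close>

definition cstar_seminorm :: "('a, 'b) star_algebra_scheme \<Rightarrow> ('a \<Rightarrow> real) \<Rightarrow> bool" where
  "cstar_seminorm A p \<longleftrightarrow>
     (\<forall>x\<in>carrier A. 0 \<le> p x) \<and>
     (\<forall>x\<in>carrier A. \<forall>y\<in>carrier A. p (x \<oplus>\<^bsub>A\<^esub> y) \<le> p x + p y) \<and>
     (\<forall>c. \<forall>x\<in>carrier A. p (c \<odot>\<^bsub>A\<^esub> x) = cmod c * p x) \<and>
     (\<forall>x\<in>carrier A. \<forall>y\<in>carrier A. p (x \<otimes>\<^bsub>A\<^esub> y) \<le> p x * p y) \<and>
     (\<forall>x\<in>carrier A. p (adj A x \<otimes>\<^bsub>A\<^esub> x) = (p x)\<^sup>2)"

definition univ_seminorm :: "('a, 'b) star_algebra_scheme \<Rightarrow> 'a set \<Rightarrow> 'a \<Rightarrow> real" where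
  "univ_seminorm A Rel a = (SUP p \<in> {p. cstar_seminorm A p \<and> (\<forall>r\<in>Rel. p r = 0)}. p a)"

definition cauchy_seqs :: "('a, 'b) ring_scheme \<Rightarrow> ('a \<Rightarrow> real) \<Rightarrow> (nat \<Rightarrow> 'a) set" where
  "cauchy_seqs A p = {x. (\<forall>k. x k \<in> carrier A) \<and>
     (\<forall>e>0. \<exists>N. \<forall>j\<ge>N. \<forall>k\<ge>N. p (x j \<ominus>\<^bsub>A\<^esub> x k) < e)}"

definition null_seqs :: "('a, 'b) ring_scheme \<Rightarrow> ('a \<Rightarrow> real) \<Rightarrow> (nat \<Rightarrow> 'a) set" where
  "null_seqs A p = {x. (\<forall>k. x k \<in> carrier A) \<and> (\<lambda>k. p (x k)) \<longlonglongrightarrow> 0}"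

definition cauchy_algebra ::
  "('a, 'b) star_algebra_scheme \<Rightarrow> ('a \<Rightarrow> real) \<Rightarrow> (nat \<Rightarrow> 'a) normed_star_algebra" where
  "cauchy_algebra A p =
     \<lparr>carrier = cauchy_seqs A p,
      mult = (\<lambda>x y k. x k \<otimes>\<^bsub>A\<^esub> y k), one = (\<lambda>k. \<one>\<^bsub>A\<^esub>),
      zero = (\<lambda>k. \<zero>\<^bsub>A\<^esub>), add = (\<lambda>x y k. x k \<oplus>\<^bsub>A\<^esub> y k),
      smult = (\<lambda>c x k. c \<odot>\<^bsub>A\<^esub> x k), adj = (\<lambda>x k. adj A (x k)),
      cnorm = (\<lambda>x. lim (\<lambda>k. p (x k)))\<rparr>"

definition completion ::
  "('a, 'b) star_algebra_scheme \<Rightarrow> ('a \<Rightarrow> real) \<Rightarrow> (nat \<Rightarrow> 'a) set normed_star_algebra" where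
  "completion A p = quot_algebra (cauchy_algebra A p) (null_seqs A p)"

definition to_completion ::
  "('a, 'b) star_algebra_scheme \<Rightarrow> ('a \<Rightarrow> real) \<Rightarrow> 'a \<Rightarrow> (nat \<Rightarrow> 'a) set" where
  "to_completion A p a = null_seqs A p +>\<^bsub>cauchy_algebra A p\<^esub> (\<lambda>k. a)"

definition univ_cstar ::
  "'g set \<Rightarrow> 'g free_alg set \<Rightarrow> (nat \<Rightarrow> 'g free_alg) set normed_star_algebra" where
  "univ_cstar G Rel =
     completion (free_star_algebra G) (univ_seminorm (free_star_algebra G) Rel)"

definition univ_cstar_gen ::
  "'g set \<Rightarrow> 'g free_alg set \<Rightarrow> 'g \<Rightarrow> (nat \<Rightarrow> 'g free_alg) set" where
  "univ_cstar_gen G Rel g =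
     to_completion (free_star_algebra G) (univ_seminorm (free_star_algebra G) Rel) (free_gen g)"


section \<open>The algebras \<open>L\<^sub>n\<^sub>,\<^sub>m\<close> and \<open>O\<^sub>n\<^sub>,\<^sub>m\<close>\<close>

datatype gen = GenS nat | GenT nat

definition L_gens :: "nat \<Rightarrow> nat \<Rightarrow> gen set" where
  "L_gens n m = GenS ` {1..n} \<union> GenT ` {1..m}"

text \<open>
  A relation \<open>a = b\<close> is encoded as the element \<open>a - b\<close>.  The equality of all \<open>s\<^sub>i\<^sup>*s\<^sub>i\<close> among
  themselves, and of all \<open>t\<^sub>j\<^sup>*t\<^sub>j\<close>, is contained in the relations \<open>s\<^sub>i\<^sup>*s\<^sub>i = t\<^sub>j\<^sup>*t\<^sub>j\<close> for all
  \<open>i\<close>, \<open>j\<close>; accordingly \<open>q\<close> may be written as \<open>s\<^sub>i\<^sup>*s\<^sub>i\<close> for any \<open>i\<close>.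
\<close>

definition L_rels :: "nat \<Rightarrow> nat \<Rightarrow> gen free_alg set" where
  "L_rels n m =
    (let s = (\<lambda>i. free_gen (GenS i)); s' = (\<lambda>i. free_adj (s i));
         t = (\<lambda>j. free_gen (GenT j)); t' = (\<lambda>j. free_adj (t j));
         p = (\<Sum>i\<in>{1..n}. s i * s' i) in
      {s i * s' i * s i - s i | i. i \<in> {1..n}} \<union>
      {t j * t' j * t j - t j | j. j \<in> {1..m}} \<union>
      {s' i * s k | i k. i \<in> {1..n} \<and> k \<in> {1..n} \<and> i \<noteq> k} \<union>
      {t' j * t l | j l. j \<in> {1..m} \<and> l \<in> {1..m} \<and> j \<noteq> l} \<union>
      {s' i * s i - t' j * t j | i j. i \<in> {1..n} \<and> j \<in> {1..m}} \<union>
      {p - (\<Sum>j\<in>{1..m}. t j * t' j)} \<union>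
      {p * (s' i * s i) | i. i \<in> {1..n}} \<union>
      {p + s' i * s i - 1 | i. i \<in> {1..n}})"

definition alg_L :: "nat \<Rightarrow> nat \<Rightarrow> (nat \<Rightarrow> gen free_alg) set normed_star_algebra" where
  "alg_L n m = univ_cstar (L_gens n m) (L_rels n m)"

definition L_gen :: "nat \<Rightarrow> nat \<Rightarrow> gen \<Rightarrow> (nat \<Rightarrow> gen free_alg) set" where
  "L_gen n m = univ_cstar_gen (L_gens n m) (L_rels n m)"

definition L_semigroup :: "nat \<Rightarrow> nat \<Rightarrow> (nat \<Rightarrow> gen free_alg) set set" where
  "L_semigroup n m = semigroup_gen (alg_L n m)
     (L_gen n m ` L_gens n m \<union> (\<lambda>g. adj (alg_L n m) (L_gen n m g)) ` L_gens n m)"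

text \<open>
  The generators of \<open>J\<close> form a self-adjoint set, since \<open>(xx\<^sup>*x - x)\<^sup>* = yy\<^sup>*y - y\<close> with \<open>y = x\<^sup>*\<close>,
  which lies again in the semigroup.  Hence \<open>J\<close> is self-adjoint and \<open>quot_algebra\<close> applies.
\<close>

definition ideal_J :: "nat \<Rightarrow> nat \<Rightarrow> (nat \<Rightarrow> gen free_alg) set set" where
  "ideal_J n m = closed_ideal_gen (alg_L n m)
     {x \<otimes>\<^bsub>alg_L n m\<^esub> adj (alg_L n m) x \<otimes>\<^bsub>alg_L n m\<^esub> x \<ominus>\<^bsub>alg_L n m\<^esub> x | x. x \<in> L_semigroup n m}"

definition alg_O :: "nat \<Rightarrow> nat \<Rightarrow> (nat \<Rightarrow> gen free_alg) set set normed_star_algebra" where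
  "alg_O n m = quot_algebra (alg_L n m) (ideal_J n m)"

definition O_s :: "nat \<Rightarrow> nat \<Rightarrow> nat \<Rightarrow> (nat \<Rightarrow> gen free_alg) set set" where
  "O_s n m i = ideal_J n m +>\<^bsub>alg_L n m\<^esub> L_gen n m (GenS i)"

definition O_t :: "nat \<Rightarrow> nat \<Rightarrow> nat \<Rightarrow> (nat \<Rightarrow> gen free_alg) set set" where
  "O_t n m j = ideal_J n m +>\<^bsub>alg_L n m\<^esub> L_gen n m (GenT j)"

definition O_S :: "nat \<Rightarrow> nat \<Rightarrow> (nat \<Rightarrow> gen free_alg) set set" where
  "O_S n m = complex_of_real (1 / sqrt (real n)) \<odot>\<^bsub>alg_O n m\<^esub>
     (\<Oplus>\<^bsub>alg_O n m\<^esub>i\<in>{1..n}. O_s n m i)"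

definition O_T :: "nat \<Rightarrow> nat \<Rightarrow> (nat \<Rightarrow> gen free_alg) set set" where
  "O_T n m = complex_of_real (1 / sqrt (real m)) \<odot>\<^bsub>alg_O n m\<^esub>
     (\<Oplus>\<^bsub>alg_O n m\<^esub>j\<in>{1..m}. O_t n m j)"

definition O_R :: "nat \<Rightarrow> nat \<Rightarrow> (nat \<Rightarrow> gen free_alg) set set" where
  "O_R n m = O_S n m \<otimes>\<^bsub>alg_O n m\<^esub> adj (alg_O n m) (O_T n m)"


section \<open>Well-definedness\<close>

text \<open>
  The supremum defining the universal seminorm is finite and is itself a C*-seminorm; the
  quotients above are quotients by two-sided ideals, hence rings, and the adjoint on
  \<open>L\<^sub>n\<^sub>,\<^sub>m\<close> does not depend on representatives.
\<close>

lemma free_star_algebra_simps [simp]: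
  "mult (free_star_algebra G) = (*)" "one (free_star_algebra G) = 1"
  "zero (free_star_algebra G) = 0" "add (free_star_algebra G) = (+)"
  "smult (free_star_algebra G) = (\<lambda>c a. Poly_Mapping.single 0 c * a)"
  "adj (free_star_algebra G) = free_adj"
  by (simp_all add: free_star_algebra_def)

lemma free_carrier_iff:
  "a \<in> carrier (free_star_algebra G) \<longleftrightarrow> (\<forall>w\<in>Poly_Mapping.keys a. fst ` set (letters w) \<subseteq> G)"
  by (simp add: free_star_algebra_def)

lemma free_carrier_closed [simp, intro]:
  shows "0 \<in> carrier (free_star_algebra G)" "1 \<in> carrier (free_star_algebra G)"
    "a \<in> carrier (free_star_algebra G) \<Longrightarrow> b \<in> carrier (free_star_algebra G) \<Longrightarrow>
       a + b \<in> carrier (free_star_algebra G)"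
    "a \<in> carrier (free_star_algebra G) \<Longrightarrow> b \<in> carrier (free_star_algebra G) \<Longrightarrow>
       a - b \<in> carrier (free_star_algebra G)"
    "a \<in> carrier (free_star_algebra G) \<Longrightarrow> - a \<in> carrier (free_star_algebra G)"
    "a \<in> carrier (free_star_algebra G) \<Longrightarrow> b \<in> carrier (free_star_algebra G) \<Longrightarrow>
       a * b \<in> carrier (free_star_algebra G)"
proof -
  show "0 \<in> carrier (free_star_algebra G)" "1 \<in> carrier (free_star_algebra G)"
    by (simp_all add: free_carrier_iff zero_word_def)
  show "a + b \<in> carrier (free_star_algebra G)" "a - b \<in> carrier (free_star_algebra G)"
    if "a \<in> carrier (free_star_algebra G)" "b \<in> carrier (free_star_algebra G)"
    using that keys_add[of a b] keys_diff[of a b] by (auto simp: free_carrier_iff subset_iff)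
  show "- a \<in> carrier (free_star_algebra G)" if "a \<in> carrier (free_star_algebra G)"
    using that by (auto simp: free_carrier_iff)
  show "a * b \<in> carrier (free_star_algebra G)"
    if "a \<in> carrier (free_star_algebra G)" "b \<in> carrier (free_star_algebra G)"
    using that keys_mult[of a b] by (fastforce simp: free_carrier_iff plus_word_def subset_iff)
qed

lemma free_carrier_single [simp]:
  "Poly_Mapping.single w c \<in> carrier (free_star_algebra G) \<longleftrightarrow>
     c = 0 \<or> fst ` set (letters w) \<subseteq> G"
  by (simp add: free_carrier_iff)

lemma ring_free_star_algebra: "ring (free_star_algebra G)"
proof (rule ringI)
  show "abelian_group (free_star_algebra G)"
  proof (rule abelian_groupI)
    fix x assume "x \<in> carrier (free_star_algebra G)"
    then show "\<exists>y\<in>carrier (free_star_algebra G). y \<oplus>\<^bsub>free_star_algebra G\<^esub> x = \<zero>\<^bsub>free_star_algebra G\<^esub>"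
      by (intro bexI[of _ "- x"]) auto
  qed (auto simp: add_ac)
  show "monoid (free_star_algebra G)"
    by (rule monoidI) (auto simp: mult.assoc)
qed (auto simp: algebra_simps)

lemma free_a_minus [simp]:
  assumes "a \<in> carrier (free_star_algebra G)" "b \<in> carrier (free_star_algebra G)"
  shows "a \<ominus>\<^bsub>free_star_algebra G\<^esub> b = a - b"
proof -
  interpret ring "free_star_algebra G" by (rule ring_free_star_algebra)
  have "\<ominus>\<^bsub>free_star_algebra G\<^esub> b = - b"
    by (rule minus_equality) (use assms in auto)
  then show ?thesis by (simp add: a_minus_def)
qed

lemma free_adj_single [simp]:
  "free_adj (Poly_Mapping.single w c) = Poly_Mapping.single (word_adj w) (cnj c)"
  by (simp add: free_adj_def)

lemma word_adj_word_adj [simp]: "word_adj (word_adj w) = w"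
  by (cases w) (simp add: word_adj_def rev_map comp_def case_prod_beta)

lemma word_adj_plus: "word_adj (u + v) = word_adj v + word_adj u"
  by (simp add: word_adj_def plus_word_def)

lemma fst_set_word_adj [simp]: "fst ` set (letters (word_adj w)) = fst ` set (letters w)"
  by (force simp: word_adj_def image_image)

lemma free_adj_carrier [simp]:
  assumes "a \<in> carrier (free_star_algebra G)"
  shows "free_adj a \<in> carrier (free_star_algebra G)"
proof -
  have sum: "(\<Sum>w\<in>K. f w) \<in> carrier (free_star_algebra G)"
    if "finite K" "\<And>w. w \<in> K \<Longrightarrow> f w \<in> carrier (free_star_algebra G)" for K :: "'a word set" and f
    using that by (induction K rule: finite_induct) auto
  have "Poly_Mapping.single (word_adj w) (cnj (Poly_Mapping.lookup a w)) \<in> carrier (free_star_algebra G)"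
    if "w \<in> Poly_Mapping.keys a" for w
    using assms that by (simp add: free_carrier_iff)
  then show ?thesis unfolding free_adj_def by (intro sum) simp_all
qed

context
  fixes G :: "'g set" and p :: "'g free_alg \<Rightarrow> real"
  assumes p: "cstar_seminorm (free_star_algebra G) p"
begin

lemma
  assumes "a \<in> carrier (free_star_algebra G)" "b \<in> carrier (free_star_algebra G)"
  shows cs_nonneg: "0 \<le> p a" and cs_add: "p (a + b) \<le> p a + p b"
    and cs_smult: "p (Poly_Mapping.single 0 c * a) = cmod c * p a"
    and cs_mult: "p (a * b) \<le> p a * p b"
    and cs_adj_mult: "p (free_adj a * a) = (p a)\<^sup>2"
  using assms p unfolding cstar_seminorm_def by simp_all

lemma cs_zero: "p 0 = 0"
  using cs_smult[of 0 0 0] by simp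

lemma cs_minus: 
  assumes "a \<in> carrier (free_star_algebra G)" shows "p (- a) = p a"
proof -
  have "Poly_Mapping.single 0 (-1) = (- 1 :: 'g free_alg)"
    by (metis single_one single_uminus)
  then show ?thesis using cs_smult[OF assms assms, of "-1"] by simp
qed

lemma cs_gen_le:
  assumes g: "g \<in> G" and 0: "p (free_gen g * free_adj (free_gen g) * free_gen g - free_gen g) = 0"
  shows "p (free_gen g) \<le> 1" "p (free_adj (free_gen g)) \<le> 1"
proof -
  define s where "s = free_gen g"
  define e where "e = free_adj s * s"
  have [simp]: "s \<in> carrier (free_star_algebra G)" "free_adj s \<in> carrier (free_star_algebra G)"
    using g by (simp_all add: s_def free_gen_def)
  have [simp]: "free_adj (free_adj s) = s"
    by (simp add: s_def free_gen_def)
  have e: "e \<in> carrier (free_star_algebra G)" "free_adj e = e"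
    using g by (simp_all add: e_def s_def free_gen_def mult_single word_adj_plus)
      (simp add: word_adj_def plus_word_def)
  have pe: "p e = (p s)\<^sup>2" by (simp add: e_def cs_adj_mult[of s s])
  have "e * e - e = free_adj s * (s * free_adj s * s - s)"
    by (simp add: e_def algebra_simps)
  then have "p (e * e - e) \<le> 0"
    using cs_mult[of "free_adj s" "s * free_adj s * s - s"] 0 by (simp add: s_def[symmetric])
  moreover have "p (e * e) \<le> p (e * e - e) + p e" "p e \<le> p (e * e) + p (- (e * e - e))"
    using cs_add[of "e * e - e" e] cs_add[of "e * e" "- (e * e - e)"] e by auto
  moreover have "p (- (e * e - e)) = p (e * e - e)"
    by (rule cs_minus) (use e in auto)
  moreover have "p (e * e - e) \<ge> 0" by (rule cs_nonneg) (use e in auto)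
  moreover have "p (e * e) = (p e)\<^sup>2" using cs_adj_mult[of e e] e by simp
  ultimately have "(p e)\<^sup>2 = p e" by linarith
  then have "p e \<le> 1" by (auto simp: power2_eq_square)
  then show "p (free_gen g) \<le> 1" using pe by (simp add: s_def[symmetric] power_le_one_iff abs_square_le_1)
  have "(p (free_adj s))\<^sup>2 \<le> p s * p (free_adj s)"
    using cs_adj_mult[of "free_adj s" "free_adj s"] cs_mult[of s "free_adj s"] by simp
  then have "p (free_adj s) * p (free_adj s) \<le> p s * p (free_adj s)"
    by (simp only: power2_eq_square)
  moreover have "p s * p (free_adj s) < p (free_adj s) * p (free_adj s)" if "p s < p (free_adj s)"
    by (rule mult_strict_right_mono) (use that cs_nonneg[of s 0] in auto)
  ultimately have "p (free_adj s) \<le> p s" by linarith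
  then show "p (free_adj (free_gen g)) \<le> 1" using \<open>p (free_gen g) \<le> 1\<close> by (simp add: s_def)
qed

lemma cs_le_sum:
  assumes gens: "\<And>g. g \<in> G \<Longrightarrow> p (free_gen g * free_adj (free_gen g) * free_gen g - free_gen g) = 0"
    and a: "a \<in> carrier (free_star_algebra G)"
  shows "p a \<le> (\<Sum>w\<in>Poly_Mapping.keys a. cmod (Poly_Mapping.lookup a w))"
proof -
  have one: "p 1 \<le> 1"
  proof -
    have "(p 1)\<^sup>2 = p 1"
      using cs_adj_mult[of 1 1] by (simp add: free_adj_def zero_word_def word_adj_def)
        (simp flip: zero_word_def)
    then show ?thesis by (auto simp: power2_eq_square)
  qed
  have word: "p (Poly_Mapping.single (Word ls) 1) \<le> 1" if "fst ` set ls \<subseteq> G" for ls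
    using that
  proof (induction ls)
    case Nil
    then show ?case using one by (simp flip: zero_word_def)
  next
    case (Cons l ls)
    obtain g b where l: "l = (g, b)" by fastforce
    have *: "Poly_Mapping.single (Word (l # ls)) (1::complex) =
        Poly_Mapping.single (Word [l]) 1 * Poly_Mapping.single (Word ls) 1"
      by (simp add: mult_single plus_word_def)
    have "Poly_Mapping.single (Word [l]) 1 = (if b then free_adj (free_gen g) else free_gen g)"
      by (simp add: l free_gen_def word_adj_def)
    moreover have "g \<in> G" using Cons.prems l by simp
    ultimately have "p (Poly_Mapping.single (Word [l]) 1) \<le> 1"
      using cs_gen_le[OF _ gens] by simp
    moreover have "p (Poly_Mapping.single (Word ls) 1) \<le> 1" using Cons by simp
    moreover have "0 \<le> p (Poly_Mapping.single (Word ls) 1)" "0 \<le> p (Poly_Mapping.single (Word [l]) 1)"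
      using Cons.prems by (auto intro!: cs_nonneg[of _ 0])
    ultimately have "p (Poly_Mapping.single (Word [l]) 1) * p (Poly_Mapping.single (Word ls) 1) \<le> 1"
      by (simp add: mult_le_one)
    then show ?case
      unfolding * using cs_mult[of "Poly_Mapping.single (Word [l]) 1" "Poly_Mapping.single (Word ls) 1"]
        Cons.prems by auto
  qed
  have sum: "(\<Sum>w\<in>K. Poly_Mapping.single w (Poly_Mapping.lookup a w)) \<in> carrier (free_star_algebra G) \<and>
      p (\<Sum>w\<in>K. Poly_Mapping.single w (Poly_Mapping.lookup a w)) \<le> (\<Sum>w\<in>K. cmod (Poly_Mapping.lookup a w))"
    if "finite K" "K \<subseteq> Poly_Mapping.keys a" for K
    using that
  proof (induction K rule: finite_induct)
    case empty
    then show ?case by (simp add: cs_zero)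
  next
    case (insert w K)
    have w: "fst ` set (letters w) \<subseteq> G" using a insert.prems by (auto simp: free_carrier_iff)
    have "Poly_Mapping.single w (Poly_Mapping.lookup a w) =
        Poly_Mapping.single 0 (Poly_Mapping.lookup a w) * Poly_Mapping.single w 1"
      by (simp add: mult_single)
    then have "p (Poly_Mapping.single w (Poly_Mapping.lookup a w)) =
        cmod (Poly_Mapping.lookup a w) * p (Poly_Mapping.single w 1)"
      using cs_smult[of "Poly_Mapping.single w 1" 0 "Poly_Mapping.lookup a w"] w by simp
    also have "\<dots> \<le> cmod (Poly_Mapping.lookup a w)"
      using word[of "letters w"] w by (simp add: mult_left_le)
    finally have 1: "p (Poly_Mapping.single w (Poly_Mapping.lookup a w)) \<le> cmod (Poly_Mapping.lookup a w)" .
    have "Poly_Mapping.single w (Poly_Mapping.lookup a w) \<in> carrier (free_star_algebra G)"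
      using w by simp
    with insert 1 show ?case
      using cs_add[of "Poly_Mapping.single w (Poly_Mapping.lookup a w)"
          "\<Sum>w\<in>K. Poly_Mapping.single w (Poly_Mapping.lookup a w)"] by auto
  qed
  have "(\<Sum>w\<in>Poly_Mapping.keys a. Poly_Mapping.single w (Poly_Mapping.lookup a w)) = a"
    by (intro poly_mapping_eqI)
      (auto simp: lookup_sum lookup_single when_def in_keys_iff sum.delta)
  then show ?thesis using sum[of "Poly_Mapping.keys a"] by simp
qed

end

lemma L_seminorms_bdd:
  assumes "a \<in> carrier (free_star_algebra (L_gens n m))"
  shows "bdd_above ((\<lambda>p. p a) `
    {p. cstar_seminorm (free_star_algebra (L_gens n m)) p \<and> (\<forall>r\<in>L_rels n m. p r = 0)})"
proof -
  have "free_gen g * free_adj (free_gen g) * free_gen g - free_gen g \<in> L_rels n m"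
    if "g \<in> L_gens n m" for g
    using that[unfolded L_gens_def]
  proof (elim UnE imageE)
    fix i assume "g = GenS i" "i \<in> {1..n}"
    then show ?thesis unfolding L_rels_def Let_def by blast
  next
    fix j assume "g = GenT j" "j \<in> {1..m}"
    then show ?thesis unfolding L_rels_def Let_def by blast
  qed
  then show ?thesis
    using cs_le_sum[OF _ _ assms]
    by (intro bdd_aboveI2[where M = "\<Sum>w\<in>Poly_Mapping.keys a. cmod (Poly_Mapping.lookup a w)"])
      blast
qed

lemma cstar_seminorm_zero: "cstar_seminorm A (\<lambda>_. 0)"
  by (simp add: cstar_seminorm_def)

lemma cstar_seminorm_univ:
  fixes G :: "'g set"
  defines "A \<equiv> free_star_algebra G"
  assumes bdd: "\<And>a. a \<in> carrier A \<Longrightarrow>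
      bdd_above ((\<lambda>p. p a) ` {p. cstar_seminorm A p \<and> (\<forall>r\<in>Rel. p r = 0)})"
  shows "cstar_seminorm A (univ_seminorm A Rel)"
proof -
  have adj: "free_adj x \<in> carrier A" if "x \<in> carrier A" for x
    using that by (simp add: A_def)
  define P where "P = {p. cstar_seminorm A p \<and> (\<forall>r\<in>Rel. p r = 0)}"
  have U: "univ_seminorm A Rel a = (SUP p\<in>P. p a)" for a by (simp add: univ_seminorm_def P_def)
  have ne: "P \<noteq> {}" using cstar_seminorm_zero[of A] by (auto simp: P_def)
  have P: "cstar_seminorm (free_star_algebra G) p" if "p \<in> P" for p using that by (simp add: P_def A_def)
  have up: "p a \<le> univ_seminorm A Rel a" if "p \<in> P" "a \<in> carrier A" for p a
    unfolding U by (rule cSUP_upper[OF that(1)]) (use bdd that in \<open>simp add: P_def\<close>)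
  have least: "univ_seminorm A Rel a \<le> M" if "\<And>p. p \<in> P \<Longrightarrow> p a \<le> M" for a M
    unfolding U by (rule cSUP_least[OF ne]) (rule that)
  have nn: "0 \<le> univ_seminorm A Rel a" if "a \<in> carrier A" for a
    using ne up[OF _ that] cs_nonneg[OF P, of _ a a] that unfolding A_def by force
  have sm: "univ_seminorm A Rel (Poly_Mapping.single 0 c * a) \<le> cmod c * univ_seminorm A Rel a"
    if a: "a \<in> carrier A" for c a
  proof (rule least)
    fix p assume "p \<in> P"
    then show "p (Poly_Mapping.single 0 c * a) \<le> cmod c * univ_seminorm A Rel a"
      using cs_smult[OF P, of p a a c] a up[of p a] by (simp add: A_def mult_left_mono)
  qed
  show ?thesis
    unfolding cstar_seminorm_def
  proof (intro conjI ballI allI)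
    fix x y assume x: "x \<in> carrier A" and y: "y \<in> carrier A"
    show "univ_seminorm A Rel (x \<oplus>\<^bsub>A\<^esub> y) \<le> univ_seminorm A Rel x + univ_seminorm A Rel y"
      using cs_add[OF P, of _ x y] x y up[of _ x] up[of _ y]
      by (intro least) (force simp: A_def)
    show "univ_seminorm A Rel (x \<otimes>\<^bsub>A\<^esub> y) \<le> univ_seminorm A Rel x * univ_seminorm A Rel y"
    proof (rule least)
      fix p assume p: "p \<in> P"
      have "p (x * y) \<le> p x * p y" "0 \<le> p x" "0 \<le> p y"
        using cs_mult[OF P[OF p], of x y] cs_nonneg[OF P[OF p], of x x]
          cs_nonneg[OF P[OF p], of y y] x y by (auto simp: A_def)
      moreover have "p x * p y \<le> univ_seminorm A Rel x * univ_seminorm A Rel y"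
        using up[OF p x] up[OF p y] nn[OF x] calculation by (intro mult_mono) auto
      ultimately show "p (x \<otimes>\<^bsub>A\<^esub> y) \<le> univ_seminorm A Rel x * univ_seminorm A Rel y"
        by (simp add: A_def)
    qed
  next
    fix c x assume x: "x \<in> carrier A"
    have "univ_seminorm A Rel (c \<odot>\<^bsub>A\<^esub> x) \<ge> cmod c * univ_seminorm A Rel x"
    proof (cases "c = 0")
      case True
      have "c \<odot>\<^bsub>A\<^esub> x \<in> carrier A" using x by (simp add: A_def True)
      with True nn show ?thesis by simp
    next
      case False
      have "Poly_Mapping.single 0 (inverse c) * (Poly_Mapping.single 0 c * x) = x"
        using False by (simp add: mult_single flip: mult.assoc)
      moreover have "Poly_Mapping.single 0 c * x \<in> carrier A"
        using x by (simp add: A_def free_carrier_closed zero_word_def)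
      ultimately have "univ_seminorm A Rel x \<le>
          cmod (inverse c) * univ_seminorm A Rel (Poly_Mapping.single 0 c * x)"
        using sm[of "Poly_Mapping.single 0 c * x" "inverse c"] by simp
      then show ?thesis using False by (simp add: A_def norm_inverse norm_divide field_simps)
    qed
    with sm[OF x, of c] show "univ_seminorm A Rel (c \<odot>\<^bsub>A\<^esub> x) = cmod c * univ_seminorm A Rel x"
      by (simp add: A_def)
  next
    fix x assume x: "x \<in> carrier A"
    have sq: "p (free_adj x * x) = (p x)\<^sup>2" "0 \<le> p x" if "p \<in> P" for p
      using cs_adj_mult[OF P[OF that], of x x] cs_nonneg[OF P[OF that], of x x] x by (auto simp: A_def)
    have "univ_seminorm A Rel (free_adj x * x) \<le> (univ_seminorm A Rel x)\<^sup>2"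
    proof (rule least)
      fix p assume p: "p \<in> P"
      show "p (free_adj x * x) \<le> (univ_seminorm A Rel x)\<^sup>2"
        unfolding sq(1)[OF p] by (rule power_mono[OF up[OF p x] sq(2)[OF p]])
    qed
    moreover have "univ_seminorm A Rel x \<le> sqrt (univ_seminorm A Rel (free_adj x * x))"
    proof (rule least)
      fix p assume p: "p \<in> P"
      have "(p x)\<^sup>2 \<le> univ_seminorm A Rel (free_adj x * x)"
        using sq(1)[OF p] up[OF p, of "free_adj x * x"] adj[OF x] x by (simp add: A_def free_carrier_closed)
      then show "p x \<le> sqrt (univ_seminorm A Rel (free_adj x * x))" by (rule real_le_rsqrt)
    qed
    then have "(univ_seminorm A Rel x)\<^sup>2 \<le> (sqrt (univ_seminorm A Rel (free_adj x * x)))\<^sup>2"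
      using nn[OF x] by (intro power_mono)
    then have "(univ_seminorm A Rel x)\<^sup>2 \<le> univ_seminorm A Rel (free_adj x * x)"
      using nn[of "free_adj x * x"] adj[OF x] x by (simp add: A_def free_carrier_closed)
    ultimately show "univ_seminorm A Rel (adj A x \<otimes>\<^bsub>A\<^esub> x) = (univ_seminorm A Rel x)\<^sup>2"
      by (simp add: A_def)
  qed (rule nn)
qed

lemma quot_algebra_simps [simp]:
  "carrier (quot_algebra A I) = carrier (A Quot I)" "mult (quot_algebra A I) = mult (A Quot I)"
  "one (quot_algebra A I) = one (A Quot I)" "zero (quot_algebra A I) = zero (A Quot I)"
  "add (quot_algebra A I) = add (A Quot I)"
  by (simp_all add: quot_algebra_def)

lemma quot_algebra_ring:
  assumes "ideal I A" shows "ring (quot_algebra A I)"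
proof -
  interpret Q: ring "A Quot I" by (rule ideal.quotient_is_ring[OF assms])
  show ?thesis
  proof (rule ringI)
    show "abelian_group (quot_algebra A I)"
    proof (rule abelian_groupI)
      fix x assume "x \<in> carrier (quot_algebra A I)"
      then show "\<exists>y\<in>carrier (quot_algebra A I). y \<oplus>\<^bsub>quot_algebra A I\<^esub> x = \<zero>\<^bsub>quot_algebra A I\<^esub>"
        using Q.l_neg by (intro bexI[of _ "\<ominus>\<^bsub>A Quot I\<^esub> x"]) simp_all
    qed (simp_all add: Q.a_ac)
    show "monoid (quot_algebra A I)"
      by (rule monoidI) (simp_all add: Q.m_assoc)
  qed (simp_all add: Q.l_distr Q.r_distr)
qed

context
  fixes G :: "'g set" and p :: "'g free_alg \<Rightarrow> real"
  assumes p: "cstar_seminorm (free_star_algebra G) p"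
begin

lemma cauchy_carrier:
  "x \<in> carrier (cauchy_algebra (free_star_algebra G) p) \<longleftrightarrow>
     (\<forall>k. x k \<in> carrier (free_star_algebra G)) \<and> (\<forall>e>0. \<exists>N. \<forall>j\<ge>N. \<forall>k\<ge>N. p (x j - x k) < e)"
  by (auto simp: cauchy_algebra_def cauchy_seqs_def)

lemma cauchy_ops:
  "mult (cauchy_algebra (free_star_algebra G) p) = (\<lambda>x y k. x k * y k)" "one (cauchy_algebra (free_star_algebra G) p) = (\<lambda>k. 1)" "zero (cauchy_algebra (free_star_algebra G) p) = (\<lambda>k. 0)"
  "add (cauchy_algebra (free_star_algebra G) p) = (\<lambda>x y k. x k + y k)"
  by (simp_all add: cauchy_algebra_def)

lemma cauchy_bdd:
  assumes x: "x \<in> carrier (cauchy_algebra (free_star_algebra G) p)"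
  obtains B :: real where "B > 0" "\<And>k. p (x k) \<le> B"
proof -
  have F: "x k \<in> carrier (free_star_algebra G)" for k using x by (simp add: cauchy_carrier)
  obtain N where N: "\<And>j k. j \<ge> N \<Longrightarrow> k \<ge> N \<Longrightarrow> p (x j - x k) < 1"
    using x unfolding cauchy_carrier by (meson zero_less_one)
  define B where "B = 1 + p (x N) + (\<Sum>k<N. p (x k))"
  have nn: "0 \<le> p (x k)" for k using cs_nonneg[OF p F F] .
  have "p (x k) \<le> B" for k
  proof (cases "k < N")
    case True
    then have "p (x k) \<le> (\<Sum>k<N. p (x k))" using nn by (intro member_le_sum) auto
    then show ?thesis using nn[of N] by (simp add: B_def)
  next
    case False
    have "p (x k) \<le> p (x k - x N) + p (x N)"
      using cs_add[OF p, of "x k - x N" "x N"] F by simp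
    moreover have "p (x k - x N) < 1" using N False by simp
    moreover have "0 \<le> (\<Sum>k<N. p (x k))" using nn by (simp add: sum_nonneg)
    ultimately show ?thesis unfolding B_def by linarith
  qed
  moreover have "B > 0" using nn[of N] sum_nonneg[of "{..<N}" "\<lambda>k. p (x k)"] nn
    unfolding B_def by (smt (verit))
  ultimately show thesis using that by blast
qed

lemma cauchy_add:
  assumes x: "x \<in> carrier (cauchy_algebra (free_star_algebra G) p)" and y: "y \<in> carrier (cauchy_algebra (free_star_algebra G) p)"
  shows "(\<lambda>k. x k + y k) \<in> carrier (cauchy_algebra (free_star_algebra G) p)"
  unfolding cauchy_carrier
proof (intro conjI allI impI)
  show "x k + y k \<in> carrier (free_star_algebra G)" for k using x y by (simp add: cauchy_carrier)
  fix e :: real assume "e > 0"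
  then have "e / 2 > 0" by simp
  then obtain N M where N: "\<And>j k. j \<ge> N \<Longrightarrow> k \<ge> N \<Longrightarrow> p (x j - x k) < e / 2"
    and M: "\<And>j k. j \<ge> M \<Longrightarrow> k \<ge> M \<Longrightarrow> p (y j - y k) < e / 2"
    using x y unfolding cauchy_carrier by metis
  have "p (x j + y j - (x k + y k)) < e" if "j \<ge> max N M" "k \<ge> max N M" for j k
  proof -
    have "p (x j + y j - (x k + y k)) = p ((x j - x k) + (y j - y k))" by (simp add: algebra_simps)
    also have "\<dots> \<le> p (x j - x k) + p (y j - y k)"
      using x y by (intro cs_add[OF p]) (auto simp: cauchy_carrier)
    also have "\<dots> < e" using N[of j k] M[of j k] that by simp
    finally show ?thesis .
  qed
  then show "\<exists>N. \<forall>j\<ge>N. \<forall>k\<ge>N. p (x j + y j - (x k + y k)) < e" by blast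
qed

lemma cauchy_minus:
  assumes x: "x \<in> carrier (cauchy_algebra (free_star_algebra G) p)" shows "(\<lambda>k. - x k) \<in> carrier (cauchy_algebra (free_star_algebra G) p)"
proof -
  have "p (- x j - - x k) = p (x j - x k)" for j k
    using cs_minus[OF p, of "x j - x k"] cs_minus[OF p, of "- x j + x k"] x
    by (simp add: cauchy_carrier)
  then show ?thesis using x by (simp add: cauchy_carrier)
qed

lemma cauchy_mult:
  assumes x: "x \<in> carrier (cauchy_algebra (free_star_algebra G) p)" and y: "y \<in> carrier (cauchy_algebra (free_star_algebra G) p)"
  shows "(\<lambda>k. x k * y k) \<in> carrier (cauchy_algebra (free_star_algebra G) p)"
  unfolding cauchy_carrier
proof (intro conjI allI impI)
  have Fx: "x k \<in> carrier (free_star_algebra G)" and Fy: "y k \<in> carrier (free_star_algebra G)" for k using x y by (simp_all add: cauchy_carrier)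
  show "x k * y k \<in> carrier (free_star_algebra G)" for k using Fx Fy by simp
  obtain B C where B: "B > 0" "\<And>k. p (x k) \<le> B" and C: "C > 0" "\<And>k. p (y k) \<le> C"
    using cauchy_bdd[OF x] cauchy_bdd[OF y] by metis
  fix e :: real assume "e > 0"
  then have "e / (2 * C) > 0" "e / (2 * B) > 0" using B C by simp_all
  then obtain N M where N: "\<And>j k. j \<ge> N \<Longrightarrow> k \<ge> N \<Longrightarrow> p (x j - x k) < e / (2 * C)"
    and M: "\<And>j k. j \<ge> M \<Longrightarrow> k \<ge> M \<Longrightarrow> p (y j - y k) < e / (2 * B)"
    using x y unfolding cauchy_carrier by metis
  have "p (x j * y j - x k * y k) < e" if jk: "j \<ge> max N M" "k \<ge> max N M" for j k
  proof -
    have "p (x j * y j - x k * y k) = p ((x j - x k) * y j + x k * (y j - y k))"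
      by (simp add: algebra_simps)
    also have "\<dots> \<le> p ((x j - x k) * y j) + p (x k * (y j - y k))"
      using Fx Fy by (intro cs_add[OF p]) auto
    also have "\<dots> \<le> p (x j - x k) * p (y j) + p (x k) * p (y j - y k)"
      using Fx Fy by (intro add_mono cs_mult[OF p]) auto
    also have "\<dots> \<le> p (x j - x k) * C + B * p (y j - y k)"
      using B C cs_nonneg[OF p, of "x j - x k" 0] cs_nonneg[OF p, of "y j - y k" 0] Fx Fy
      by (intro add_mono mult_left_mono mult_right_mono) auto
    also have "\<dots> < e / (2 * C) * C + B * (e / (2 * B))"
      using N[of j k] M[of j k] jk B C
      by (intro add_strict_mono mult_strict_left_mono mult_strict_right_mono) auto
    also have "\<dots> = e" using B C by simp
    finally show ?thesis .
  qed
  then show "\<exists>N. \<forall>j\<ge>N. \<forall>k\<ge>N. p (x j * y j - x k * y k) < e" by blast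
qed

lemma cauchy_const: "a \<in> carrier (free_star_algebra G) \<Longrightarrow> (\<lambda>k. a) \<in> carrier (cauchy_algebra (free_star_algebra G) p)"
  by (simp add: cauchy_carrier cs_zero[OF p])

lemma ring_cauchy_algebra: "ring (cauchy_algebra (free_star_algebra G) p)"
proof (rule ringI)
  show "abelian_group (cauchy_algebra (free_star_algebra G) p)"
  proof (rule abelian_groupI)
    fix x assume "x \<in> carrier (cauchy_algebra (free_star_algebra G) p)"
    then show "\<exists>y\<in>carrier (cauchy_algebra (free_star_algebra G) p). y \<oplus>\<^bsub>(cauchy_algebra (free_star_algebra G) p)\<^esub> x = \<zero>\<^bsub>(cauchy_algebra (free_star_algebra G) p)\<^esub>"
      by (intro bexI[of _ "\<lambda>k. - x k"]) (auto simp: cauchy_ops cauchy_minus)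
  qed (auto simp: cauchy_ops add_ac cauchy_add cauchy_const)
  show "monoid (cauchy_algebra (free_star_algebra G) p)"
    by (rule monoidI) (auto simp: cauchy_ops mult.assoc cauchy_mult cauchy_const)
qed (auto simp: cauchy_ops algebra_simps)

lemma null_seqs_iff:
  "x \<in> null_seqs (free_star_algebra G) p \<longleftrightarrow> (\<forall>k. x k \<in> carrier (free_star_algebra G)) \<and> (\<lambda>k. p (x k)) \<longlonglongrightarrow> 0"
  by (simp add: null_seqs_def)

lemma null_subset: "null_seqs (free_star_algebra G) p \<subseteq> carrier (cauchy_algebra (free_star_algebra G) p)"
proof
  fix x assume "x \<in> null_seqs (free_star_algebra G) p"
  then have lim: "(\<lambda>k. p (x k)) \<longlonglongrightarrow> 0" and F: "x k \<in> carrier (free_star_algebra G)" for k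
    by (auto simp: null_seqs_iff)
  have "\<exists>N. \<forall>j\<ge>N. \<forall>k\<ge>N. p (x j - x k) < e" if "e > 0" for e
  proof -
    obtain N where N: "\<And>k. k \<ge> N \<Longrightarrow> \<bar>p (x k)\<bar> < e / 2"
      using LIMSEQ_D[OF lim, of "e / 2"] \<open>e > 0\<close> by auto
    have "p (x j - x k) < e" if "j \<ge> N" "k \<ge> N" for j k
      using cs_add[OF p, of "x j" "- x k"] cs_minus[OF p F, of k] N[OF that(1)] N[OF that(2)] F by simp
    then show ?thesis by blast
  qed
  then show "x \<in> carrier (cauchy_algebra (free_star_algebra G) p)" using F by (simp add: cauchy_carrier)
qed

lemma null_mult:
  assumes a: "a \<in> null_seqs (free_star_algebra G) p" and x: "x \<in> carrier (cauchy_algebra (free_star_algebra G) p)"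
  shows "(\<lambda>k. x k * a k) \<in> null_seqs (free_star_algebra G) p"
    "(\<lambda>k. a k * x k) \<in> null_seqs (free_star_algebra G) p"
proof -
  have Fa: "a k \<in> carrier (free_star_algebra G)" and Fx: "x k \<in> carrier (free_star_algebra G)" for k using a x by (simp_all add: null_seqs_iff cauchy_carrier)
  have lim: "(\<lambda>k. p (a k)) \<longlonglongrightarrow> 0" using a by (simp add: null_seqs_iff)
  obtain B where B: "B > 0" "\<And>k. p (x k) \<le> B" using cauchy_bdd[OF x] by metis
  have lim': "(\<lambda>k. B * p (a k)) \<longlonglongrightarrow> 0" using tendsto_mult_left[OF lim, of B] by simp
  have nn: "0 \<le> p (a k)" "0 \<le> p (x k * a k)" "0 \<le> p (a k * x k)" for k
    using Fa Fx by (auto intro!: cs_nonneg[OF p, of _ 0])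
  have "p (x k * a k) \<le> B * p (a k)" for k
    using cs_mult[OF p Fx Fa, of k k] mult_right_mono[OF B(2) nn(1), of k k] by simp
  then have "(\<lambda>k. p (x k * a k)) \<longlonglongrightarrow> 0"
    using nn by (intro tendsto_sandwich[OF _ _ tendsto_const lim']) auto
  then show "(\<lambda>k. x k * a k) \<in> null_seqs (free_star_algebra G) p"
    using Fa Fx by (simp add: null_seqs_iff)
  have "p (a k * x k) \<le> B * p (a k)" for k
    using cs_mult[OF p Fa Fx, of k k] mult_left_mono[OF B(2) nn(1), of k k] by (simp add: mult.commute)
  then have "(\<lambda>k. p (a k * x k)) \<longlonglongrightarrow> 0"
    using nn by (intro tendsto_sandwich[OF _ _ tendsto_const lim']) auto
  then show "(\<lambda>k. a k * x k) \<in> null_seqs (free_star_algebra G) p"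
    using Fa Fx by (simp add: null_seqs_iff)
qed

lemma ideal_null_seqs: "ideal (null_seqs (free_star_algebra G) p) (cauchy_algebra (free_star_algebra G) p)"
proof (rule idealI)
  interpret ring "cauchy_algebra (free_star_algebra G) p" by (rule ring_cauchy_algebra)
  show "ring (cauchy_algebra (free_star_algebra G) p)" by (rule ring_cauchy_algebra)
  show "subgroup (null_seqs (free_star_algebra G) p) (add_monoid (cauchy_algebra (free_star_algebra G) p))"
  proof (rule group.subgroupI)
    show "group (add_monoid (cauchy_algebra (free_star_algebra G) p))" by (rule a_group)
    show "null_seqs (free_star_algebra G) p \<subseteq> carrier (add_monoid (cauchy_algebra (free_star_algebra G) p))" using null_subset by simp
    have "(\<lambda>k. 0) \<in> null_seqs (free_star_algebra G) p" by (simp add: null_seqs_iff cs_zero[OF p])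
    then show "null_seqs (free_star_algebra G) p \<noteq> {}" by blast
    fix a assume a: "a \<in> null_seqs (free_star_algebra G) p"
    have "inv\<^bsub>add_monoid (cauchy_algebra (free_star_algebra G) p)\<^esub> a = (\<lambda>k. - a k)"
      unfolding a_inv_def[symmetric]
      by (rule minus_equality) (use a null_subset cauchy_minus[of a] in \<open>auto simp: cauchy_ops\<close>)
    moreover have "p (- a k) = p (a k)" for k using a by (intro cs_minus[OF p]) (simp add: null_seqs_iff)
    ultimately show "inv\<^bsub>add_monoid (cauchy_algebra (free_star_algebra G) p)\<^esub> a \<in> null_seqs (free_star_algebra G) p"
      using a by (simp add: null_seqs_iff)
    fix b assume b: "b \<in> null_seqs (free_star_algebra G) p"
    have Fa: "a k \<in> carrier (free_star_algebra G)" and Fb: "b k \<in> carrier (free_star_algebra G)" for k using a b by (simp_all add: null_seqs_iff)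
    have lim: "(\<lambda>k. p (a k) + p (b k)) \<longlonglongrightarrow> 0"
      using tendsto_add[of "\<lambda>k. p (a k)" 0 sequentially "\<lambda>k. p (b k)" 0] a b by (simp add: null_seqs_iff)
    have "0 \<le> p (a k + b k)" "p (a k + b k) \<le> p (a k) + p (b k)" for k
      using Fa Fb by (auto intro!: cs_nonneg[OF p, of _ 0] cs_add[OF p])
    then have "(\<lambda>k. p (a k + b k)) \<longlonglongrightarrow> 0"
      by (intro tendsto_sandwich[OF _ _ tendsto_const lim]) auto
    then show "a \<otimes>\<^bsub>add_monoid (cauchy_algebra (free_star_algebra G) p)\<^esub> b \<in> null_seqs (free_star_algebra G) p"
      using Fa Fb by (simp add: null_seqs_iff cauchy_ops)
  qed
qed (simp_all add: cauchy_ops null_mult)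

end

lemma ring_alg_L: "ring (alg_L n m)"
  unfolding alg_L_def univ_cstar_def completion_def
  by (intro quot_algebra_ring ideal_null_seqs cstar_seminorm_univ L_seminorms_bdd)

lemma ideal_closed_ideal_gen:
  assumes "ring A" "X \<subseteq> carrier A" shows "ideal (closed_ideal_gen A X) A"
proof -
  interpret ring A by (rule assms(1))
  have "carrier A \<in> {I. ideal I A \<and> closed_in_norm A I \<and> X \<subseteq> I}"
    using assms oneideal by (simp add: closed_in_norm_def)
  then show ?thesis unfolding closed_ideal_gen_def by (intro i_Intersect) auto
qed

lemma quot_adj:
  assumes "ideal I A" and x: "x \<in> carrier A"
    and cl: "\<And>y. y \<in> carrier A \<Longrightarrow> adj A y \<in> carrier A"
    and add: "\<And>y z. y \<in> carrier A \<Longrightarrow> z \<in> carrier A \<Longrightarrow> adj A (y \<oplus>\<^bsub>A\<^esub> z) = adj A y \<oplus>\<^bsub>A\<^esub> adj A z"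
    and I: "\<And>y. y \<in> I \<Longrightarrow> adj A y \<in> I"
  shows "adj (quot_algebra A I) (I +>\<^bsub>A\<^esub> x) = I +>\<^bsub>A\<^esub> adj A x"
proof -
  interpret ideal I A by (rule assms(1))
  have "I +>\<^bsub>A\<^esub> adj A u = I +>\<^bsub>A\<^esub> adj A x" if u: "u \<in> I +>\<^bsub>A\<^esub> x" for u
  proof -
    obtain i where i: "i \<in> I" "u = i \<oplus>\<^bsub>A\<^esub> x" using u by (auto simp: a_r_coset_def')
    then have "adj A u = adj A i \<oplus>\<^bsub>A\<^esub> adj A x" using x by (simp add: add Icarr)
    then have "adj A u \<in> I +>\<^bsub>A\<^esub> adj A x" using i I by (auto simp: a_r_coset_def')
    from a_repr_independence[OF this cl[OF x] a_subgroup] show ?thesis by simp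
  qed
  then have "(\<Union>u\<in>I +>\<^bsub>A\<^esub> x. I +>\<^bsub>A\<^esub> adj A u) = (\<Union>u\<in>I +>\<^bsub>A\<^esub> x. I +>\<^bsub>A\<^esub> adj A x)"
    by (intro SUP_cong refl)
  moreover have "I +>\<^bsub>A\<^esub> x \<noteq> {}" using a_rcos_self[OF x] by blast
  ultimately show ?thesis by (simp add: quot_algebra_def)
qed

lemma lookup_free_adj: "Poly_Mapping.lookup (free_adj a) w = cnj (Poly_Mapping.lookup a (word_adj w))"
proof -
  have "word_adj v = w \<longleftrightarrow> v = word_adj w" for v by auto
  then show ?thesis
    by (simp add: free_adj_def lookup_sum lookup_single when_def in_keys_iff sum.delta)
qed

lemma free_adj_add: "free_adj (a + b) = free_adj a + free_adj b"
  by (rule poly_mapping_eqI) (simp add: lookup_free_adj lookup_add)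

lemma free_adj_free_adj [simp]: "free_adj (free_adj a) = a"
  by (rule poly_mapping_eqI) (simp add: lookup_free_adj)

lemma cs_adj:
  assumes p: "cstar_seminorm (free_star_algebra G) p" and a: "a \<in> carrier (free_star_algebra G)"
  shows "p (free_adj a) = p a"
proof -
  have le: "p (free_adj b) \<le> p b" if b: "b \<in> carrier (free_star_algebra G)" for b
  proof -
    have b': "free_adj b \<in> carrier (free_star_algebra G)" using b by simp
    have "p (free_adj b) * p (free_adj b) \<le> p b * p (free_adj b)"
      using cs_adj_mult[OF p b' b'] cs_mult[OF p b b'] by (simp add: power2_eq_square)
    moreover have "p b * p (free_adj b) < p (free_adj b) * p (free_adj b)" if "p b < p (free_adj b)"
      by (rule mult_strict_right_mono) (use that cs_nonneg[OF p b b] in auto)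
    ultimately show ?thesis by linarith
  qed
  have "p (free_adj (free_adj a)) \<le> p (free_adj a)" by (rule le) (use a in simp)
  then show ?thesis using le[OF a] by simp
qed

lemma cauchy_adj:
  assumes p: "cstar_seminorm (free_star_algebra G) p"
  shows "x \<in> carrier (cauchy_algebra (free_star_algebra G) p) \<Longrightarrow>
      adj (cauchy_algebra (free_star_algebra G) p) x \<in> carrier (cauchy_algebra (free_star_algebra G) p)"
    and "x \<in> null_seqs (free_star_algebra G) p \<Longrightarrow>
      adj (cauchy_algebra (free_star_algebra G) p) x \<in> null_seqs (free_star_algebra G) p"
proof -
  have adj: "adj (cauchy_algebra (free_star_algebra G) p) x = (\<lambda>k. free_adj (x k))"
    by (simp add: cauchy_algebra_def)
  have diff: "free_adj a - free_adj b = free_adj (a - b)" for a b :: "'a free_alg"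
    by (rule poly_mapping_eqI) (simp add: lookup_free_adj lookup_minus)
  show "adj (cauchy_algebra (free_star_algebra G) p) x \<in> carrier (cauchy_algebra (free_star_algebra G) p)"
    if "x \<in> carrier (cauchy_algebra (free_star_algebra G) p)"
    using that unfolding adj cauchy_carrier[OF p] diff by (simp add: cs_adj[OF p])
  show "adj (cauchy_algebra (free_star_algebra G) p) x \<in> null_seqs (free_star_algebra G) p"
    if "x \<in> null_seqs (free_star_algebra G) p"
    using that unfolding adj null_seqs_iff[OF p] by (simp add: cs_adj[OF p])
qed

lemma completion_adj:
  assumes p: "cstar_seminorm (free_star_algebra G) p"
    and x: "x \<in> carrier (cauchy_algebra (free_star_algebra G) p)"
  shows "adj (completion (free_star_algebra G) p)
      (null_seqs (free_star_algebra G) p +>\<^bsub>cauchy_algebra (free_star_algebra G) p\<^esub> x) =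
    null_seqs (free_star_algebra G) p +>\<^bsub>cauchy_algebra (free_star_algebra G) p\<^esub> (\<lambda>k. free_adj (x k))"
proof -
  have "adj (completion (free_star_algebra G) p)
      (null_seqs (free_star_algebra G) p +>\<^bsub>cauchy_algebra (free_star_algebra G) p\<^esub> x) =
    null_seqs (free_star_algebra G) p +>\<^bsub>cauchy_algebra (free_star_algebra G) p\<^esub>
      adj (cauchy_algebra (free_star_algebra G) p) x"
    unfolding completion_def
    by (intro quot_adj ideal_null_seqs cauchy_adj p x) (simp_all add: cauchy_algebra_def free_adj_add)
  then show ?thesis by (simp add: cauchy_algebra_def)
qed

lemma completion_carrierI:
  assumes p: "cstar_seminorm (free_star_algebra G) p"
    and x: "x \<in> carrier (cauchy_algebra (free_star_algebra G) p)"
  shows "null_seqs (free_star_algebra G) p +>\<^bsub>cauchy_algebra (free_star_algebra G) p\<^esub> x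
    \<in> carrier (completion (free_star_algebra G) p)"
proof -
  interpret ideal "null_seqs (free_star_algebra G) p" "cauchy_algebra (free_star_algebra G) p"
    by (rule ideal_null_seqs[OF p])
  show ?thesis
    by (simp add: completion_def FactRing_def a_rcosetsI[OF a_subset x])
qed

lemma L_semigroup_carrier: "L_semigroup n m \<subseteq> carrier (alg_L n m)"
proof
  define G where "G = L_gens n m"
  define p where "p = univ_seminorm (free_star_algebra G) (L_rels n m)"
  have p: "cstar_seminorm (free_star_algebra G) p"
    unfolding p_def G_def by (intro cstar_seminorm_univ L_seminorms_bdd)
  have L: "alg_L n m = completion (free_star_algebra G) p"
    by (simp add: alg_L_def univ_cstar_def p_def G_def)
  have gen: "L_gen n m g = null_seqs (free_star_algebra G) p
      +>\<^bsub>cauchy_algebra (free_star_algebra G) p\<^esub> (\<lambda>k. free_gen g)" for g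
    by (simp add: L_gen_def univ_cstar_gen_def to_completion_def p_def G_def)
  have free: "free_gen g \<in> carrier (free_star_algebra G)" if "g \<in> L_gens n m" for g
    using that by (simp add: free_gen_def G_def)
  interpret ring "alg_L n m" by (rule ring_alg_L)
  fix x assume "x \<in> L_semigroup n m"
  then show "x \<in> carrier (alg_L n m)"
    unfolding L_semigroup_def
  proof (induction rule: semigroup_gen.induct)
    case (incl x)
    then consider g where "g \<in> L_gens n m" "x = L_gen n m g"
      | g where "g \<in> L_gens n m" "x = adj (alg_L n m) (L_gen n m g)" by blast
    then show ?case
    proof cases
      case 1
      then show ?thesis unfolding 1(2) L gen by (intro completion_carrierI p cauchy_const free)
    next
      case 2
      have "(\<lambda>k. free_gen g) \<in> carrier (cauchy_algebra (free_star_algebra G) p)"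
        by (intro cauchy_const p free 2)
      then have "x = null_seqs (free_star_algebra G) p
          +>\<^bsub>cauchy_algebra (free_star_algebra G) p\<^esub> (\<lambda>k. free_adj (free_gen g))"
        unfolding 2(2) L gen by (rule completion_adj[OF p])
      then show ?thesis unfolding L
        using 2 by (simp only:) (intro completion_carrierI p cauchy_const free free_adj_carrier)
    qed
  qed simp
qed

lemma ideal_ideal_J: "ideal (ideal_J n m) (alg_L n m)"
proof -
  define p where "p = univ_seminorm (free_star_algebra (L_gens n m)) (L_rels n m)"
  have p: "cstar_seminorm (free_star_algebra (L_gens n m)) p"
    unfolding p_def by (intro cstar_seminorm_univ L_seminorms_bdd)
  have L: "alg_L n m = completion (free_star_algebra (L_gens n m)) p"
    by (simp add: alg_L_def univ_cstar_def p_def)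
  interpret ring "alg_L n m" by (rule ring_alg_L)
  have adj: "adj (alg_L n m) x \<in> carrier (alg_L n m)" if x: "x \<in> carrier (alg_L n m)" for x
  proof -
    have "x \<in> carrier (cauchy_algebra (free_star_algebra (L_gens n m)) p Quot
        null_seqs (free_star_algebra (L_gens n m)) p)"
      using x by (simp add: L completion_def)
    then obtain y where y: "y \<in> carrier (cauchy_algebra (free_star_algebra (L_gens n m)) p)"
      "x = null_seqs (free_star_algebra (L_gens n m)) p
        +>\<^bsub>cauchy_algebra (free_star_algebra (L_gens n m)) p\<^esub> y"
      by (auto simp: FactRing_simps)
    show ?thesis
      using cauchy_adj(1)[OF p y(1)] completion_carrierI[OF p]
      unfolding y(2) L completion_adj[OF p y(1)] by (simp add: cauchy_algebra_def)
  qed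
  show ?thesis
    unfolding ideal_J_def
    by (rule ideal_closed_ideal_gen[OF ring_alg_L]) (use L_semigroup_carrier adj in blast)
qed

lemma ring_alg_O: "ring (alg_O n m)"
  unfolding alg_O_def by (intro quot_algebra_ring ideal_ideal_J)

end

theory Submission
  imports Defs "HOL-Analysis.L2_Norm"
begin

text \<open>
  Put \<open>W = T\<^sup>*S\<close>. The relations give \<open>S\<^sup>*S = T\<^sup>*T = q\<close>, \<open>S q = S\<close> and \<open>T q = T\<close>, so \<open>R\<close> is a partial
  isometry, and \<open>R\<^sup>2 = S W T\<^sup>*\<close> is one if and only if \<open>W W\<^sup>* W = W\<close>. This fails already in a
  representation by partial injections, where every word in the generators is automatically a
  partial isometry: on two copies of the integers let \<open>s\<^sub>i\<close> send \<open>x\<close> to \<open>n x + (i - 1)\<close> and \<open>t\<^sub>j\<close>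
  send \<open>y\<close> to \<open>m y + j\<close>. Up to a scalar, \<open>W\<close> is the biadjacency matrix of the bipartite graph in
  which \<open>z\<close> is an edge between \<open>z div n\<close> and \<open>(z - 1) div m\<close>. In this graph the left vertex \<open>-1\<close>
  and the right vertex \<open>0\<close> are not adjacent, but the edges \<open>-1\<close>, \<open>0\<close>, \<open>1\<close> form a path of length
  three between them, so \<open>W W\<^sup>* W\<close> has a positive entry where \<open>W\<close> vanishes. Finitely supported
  functions suffice here: the operator norm on them is a C*-seminorm without any completion.
\<close>

section \<open>Operators given by partial injections\<close>

text \<open>Every element is the finite sum of its monomials, and zero is a monomial with
  coefficient 0. Identities that are additive in each argument thus reduce to words.\<close>

lemma free_alg_induct [case_names single add]:
  fixes a :: "'g free_alg"
  assumes single: "\<And>w c. P (Poly_Mapping.single w c)"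
    and add: "\<And>a b. P a \<Longrightarrow> P b \<Longrightarrow> P (a + b)"
  shows "P a"
proof -
  have "P (\<Sum>w\<in>K. Poly_Mapping.single w (Poly_Mapping.lookup a w))" if "finite K" for K
    using that
  proof (induction K rule: finite_induct)
    case empty
    then show ?case using single[of 0 0] by simp
  qed (simp add: single add)
  moreover have "(\<Sum>w\<in>Poly_Mapping.keys a. Poly_Mapping.single w (Poly_Mapping.lookup a w)) = a"
    by (intro poly_mapping_eqI)
      (auto simp: lookup_sum lookup_single when_def in_keys_iff sum.delta)
  ultimately show ?thesis by (metis finite_keys)
qed

lemma free_adj_mult: "free_adj (a * b) = free_adj b * free_adj a"
proof (induction a rule: free_alg_induct)
  case (single u c)
  show ?case
    by (induction b rule: free_alg_induct)
      (simp_all add: mult_single word_adj_plus free_adj_add algebra_simps)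
qed (simp add: free_adj_add algebra_simps)

lemma word_adj_0 [simp]: "word_adj 0 = 0"
  by (simp add: word_adj_def zero_word_def)

lemma free_adj_0 [simp]: "free_adj 0 = 0"
  by (simp add: free_adj_def)

lemma free_adj_minus: "free_adj (a - b) = free_adj a - free_adj b"
  by (rule poly_mapping_eqI) (simp add: lookup_free_adj lookup_minus)

lemma free_adj_sum: "free_adj (\<Sum>i\<in>I. f i) = (\<Sum>i\<in>I. free_adj (f i))"
  by (induction I rule: infinite_finite_induct) (simp_all add: free_adj_add)

section \<open>Finitely supported functions as an inner product space\<close>

definition fin_supp :: "('x \<Rightarrow> complex) \<Rightarrow> bool" where
  "fin_supp f \<longleftrightarrow> finite {x. f x \<noteq> 0}"

text \<open>On an infinite support the sum defaults to 0, so the value is the l2 norm only together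
  with \<open>fin_supp\<close>.\<close>

definition l2 :: "('x \<Rightarrow> complex) \<Rightarrow> real" where
  "l2 f = L2_set (\<lambda>x. cmod (f x)) {x. f x \<noteq> 0}"

definition ip :: "('x \<Rightarrow> complex) \<Rightarrow> ('x \<Rightarrow> complex) \<Rightarrow> complex" where
  "ip f g = (\<Sum>x | f x \<noteq> 0. f x * cnj (g x))"

lemma l2_superset:
  assumes "finite B" "\<And>x. f x \<noteq> 0 \<Longrightarrow> x \<in> B"
  shows "l2 f = L2_set (\<lambda>x. cmod (f x)) B"
  unfolding l2_def L2_set_def
  by (rule arg_cong[where f = sqrt], rule sum.mono_neutral_left) (use assms in auto)

text \<open>Terms outside the common support vanish. Hence the support of the second factor can
  serve as index set when the support of the first, an image under the representation, is not
  explicit.\<close>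

lemma ip_superset:
  assumes "finite B" "fin_supp f" "\<And>x. f x \<noteq> 0 \<Longrightarrow> g x \<noteq> 0 \<Longrightarrow> x \<in> B"
  shows "ip f g = (\<Sum>x\<in>B. f x * cnj (g x))"
  unfolding ip_def
  by (rule sum.mono_neutral_cong) (use assms in \<open>auto simp: fin_supp_def\<close>)

lemma l2_nonneg [simp]: "0 \<le> l2 f"
  by (simp add: l2_def)

lemma fin_supp_zero [simp]: "fin_supp (\<lambda>x. 0)" and l2_zero [simp]: "l2 (\<lambda>x. 0) = 0"
  by (simp_all add: fin_supp_def l2_def)

lemma fin_supp_scale [simp]: "fin_supp f \<Longrightarrow> fin_supp (\<lambda>x. c * f x)"
  unfolding fin_supp_def by (rule finite_subset) auto

lemma fin_supp_add [simp]: "fin_supp f \<Longrightarrow> fin_supp g \<Longrightarrow> fin_supp (\<lambda>x. f x + g x)"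
  unfolding fin_supp_def
  by (rule finite_subset[of _ "{x. f x \<noteq> 0} \<union> {x. g x \<noteq> 0}"]) auto

lemma l2_scale:
  assumes "fin_supp f" shows "l2 (\<lambda>x. c * f x) = cmod c * l2 f"
  using l2_superset[of "{x. f x \<noteq> 0}" "\<lambda>x. c * f x"] assms
  by (simp add: fin_supp_def norm_mult l2_def L2_set_right_distrib)

lemma l2_triangle:
  assumes "fin_supp f" "fin_supp g" shows "l2 (\<lambda>x. f x + g x) \<le> l2 f + l2 g"
proof -
  define B where "B = {x. f x \<noteq> 0} \<union> {x. g x \<noteq> 0}"
  have B: "finite B" using assms by (simp add: B_def fin_supp_def)
  have "l2 (\<lambda>x. f x + g x) = L2_set (\<lambda>x. cmod (f x + g x)) B"
    by (rule l2_superset[OF B]) (auto simp: B_def)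
  also have "\<dots> \<le> L2_set (\<lambda>x. cmod (f x) + cmod (g x)) B"
    by (rule L2_set_mono) (simp_all add: norm_triangle_ineq)
  also have "\<dots> \<le> L2_set (\<lambda>x. cmod (f x)) B + L2_set (\<lambda>x. cmod (g x)) B"
    by (rule L2_set_triangle_ineq)
  also have "\<dots> = l2 f + l2 g"
    using l2_superset[OF B, of f] l2_superset[OF B, of g] by (simp add: B_def)
  finally show ?thesis .
qed

lemma ip_cauchy_schwarz:
  assumes "fin_supp f" "fin_supp g" shows "cmod (ip f g) \<le> l2 f * l2 g"
proof -
  define B where "B = {x. f x \<noteq> 0} \<union> {x. g x \<noteq> 0}"
  have B: "finite B" using assms by (simp add: B_def fin_supp_def)
  have "ip f g = (\<Sum>x\<in>B. f x * cnj (g x))"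
    by (rule ip_superset[OF B assms(1)]) (auto simp: B_def)
  then have "cmod (ip f g) \<le> (\<Sum>x\<in>B. \<bar>cmod (f x)\<bar> * \<bar>cmod (g x)\<bar>)"
    using norm_sum[of "\<lambda>x. f x * cnj (g x)" B] by (simp add: norm_mult)
  also have "\<dots> \<le> L2_set (\<lambda>x. cmod (f x)) B * L2_set (\<lambda>x. cmod (g x)) B"
    by (rule L2_set_mult_ineq)
  also have "\<dots> = l2 f * l2 g"
    using l2_superset[OF B, of f] l2_superset[OF B, of g] by (simp add: B_def)
  finally show ?thesis .
qed

lemma ip_self: "ip f f = of_real ((l2 f)\<^sup>2)"
  by (simp add: ip_def l2_def L2_set_def sum_nonneg complex_norm_square del: of_real_power)

lemma l2_eq_0:
  assumes "fin_supp f" "l2 f = 0" shows "f x = 0"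
  using assms L2_set_eq_0_iff[of "{x. f x \<noteq> 0}" "\<lambda>x. cmod (f x)"]
  by (auto simp: l2_def fin_supp_def)

section \<open>The representation attached to a partial action\<close>

text \<open>Flipping the flag of a letter inverts its partial map, which is therefore injective. The
  induced operator on functions is a partial isometry, and its adjoint belongs to the flipped
  letter.\<close>

locale partial_action =
  fixes act1 :: "'g \<times> bool \<Rightarrow> 'x \<Rightarrow> 'x option"
  assumes act1_inverse: "act1 (g, b) x = Some y \<longleftrightarrow> act1 (g, \<not> b) y = Some x"
begin

text \<open>The last letter acts first, as in a product of operators, so that concatenation becomes
  composition.\<close>

primrec act_list :: "('g \<times> bool) list \<Rightarrow> 'x \<Rightarrow> 'x option" where
  "act_list [] x = Some x"
| "act_list (l # ls) x = Option.bind (act_list ls x) (act1 l)"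

definition act :: "'g word \<Rightarrow> 'x \<Rightarrow> 'x option" where
  "act w = act_list (letters w)"

lemma act_list_append: "act_list (u @ v) x = Option.bind (act_list v x) (act_list u)"
proof (induction u)
  case Nil
  then show ?case by (cases "act_list v x") simp_all
next
  case (Cons l u)
  then show ?case by (cases "act_list v x") simp_all
qed

lemma act_plus: "act (u + v) x = Option.bind (act v x) (act u)"
  by (simp add: act_def plus_word_def act_list_append)

lemma act_0 [simp]: "act 0 x = Some x"
  by (simp add: act_def zero_word_def)

lemma act_adj: "act (word_adj w) y = Some x \<longleftrightarrow> act w x = Some y"
proof -
  have "act_list (rev (map (\<lambda>(g, b). (g, \<not> b)) ls)) y = Some x \<longleftrightarrow> act_list ls x = Some y" for ls
  proof (induction ls arbitrary: x y)
    case (Cons l ls)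
    obtain g b where l: "l = (g, b)" by fastforce
    show ?case
      by (auto simp: l act_list_append bind_eq_Some_conv Cons.IH act1_inverse[of g b])
  qed auto
  then show ?thesis by (simp add: act_def word_adj_def)
qed

text \<open>The linear extension of the rule that a word \<open>w\<close> sends the point mass at
  \<open>x\<close> to the point mass at \<open>w x\<close>. Pulling back along
  \<open>word_adj w\<close> reads the value at \<open>y\<close> off its only possible preimage;
  outside the range of \<open>w\<close> the default is 0.\<close>

definition rep :: "'g free_alg \<Rightarrow> ('x \<Rightarrow> complex) \<Rightarrow> 'x \<Rightarrow> complex" where
  "rep a f y = (\<Sum>w\<in>Poly_Mapping.keys a. Poly_Mapping.lookup a w * case_option 0 f (act (word_adj w) y))"

lemma rep_superset:
  assumes "finite K" "Poly_Mapping.keys a \<subseteq> K"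
  shows "rep a f y = (\<Sum>w\<in>K. Poly_Mapping.lookup a w * case_option 0 f (act (word_adj w) y))"
  unfolding rep_def by (rule sum.mono_neutral_left) (use assms in \<open>auto simp: in_keys_iff\<close>)

lemma rep_single: "rep (Poly_Mapping.single w c) f y = c * case_option 0 f (act (word_adj w) y)"
  using rep_superset[of "{w}" "Poly_Mapping.single w c"] by simp

lemma rep_add: "rep (a + b) f y = rep a f y + rep b f y"
proof -
  let ?K = "Poly_Mapping.keys a \<union> Poly_Mapping.keys b"
  show ?thesis
    using rep_superset[of ?K "a + b" f y] rep_superset[of ?K a f y] rep_superset[of ?K b f y]
      keys_add[of a b]
    by (simp add: lookup_add algebra_simps sum.distrib)
qed

lemma rep_0: "rep 0 f y = 0"
  by (simp add: rep_def)

lemma rep_minus: "rep (a - b) f y = rep a f y - rep b f y"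
  using rep_add[of "a - b" b f y] by simp

lemma rep_sum: "rep (\<Sum>i\<in>I. a i) f y = (\<Sum>i\<in>I. rep (a i) f y)"
  by (induction I rule: infinite_finite_induct) (simp_all add: rep_add rep_0)

lemma rep_one: "rep 1 f y = f y"
  using rep_single[of 0 1 f y] by simp

lemma rep_arg_add: "rep a (\<lambda>x. f x + g x) y = rep a f y + rep a g y"
  by (simp add: rep_def algebra_simps flip: sum.distrib)
    (intro sum.cong refl, simp add: algebra_simps split: option.split)

lemma rep_arg_scale: "rep a (\<lambda>x. c * f x) y = c * rep a f y"
  by (simp add: rep_def sum_distrib_left) (intro sum.cong refl, simp split: option.split)

text \<open>On words two reversals cancel: the adjoint reverses a product, and pulling functions
  back reverses composition.\<close>

lemma rep_mult: "rep (a * b) f y = rep a (rep b f) y"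
proof (induction a rule: free_alg_induct)
  case (single u c)
  show ?case
  proof (induction b rule: free_alg_induct)
    case (single v d)
    show ?case
      by (simp add: mult_single rep_single word_adj_plus act_plus split: option.split bind_split)
  next
    case (add a b)
    have "rep (a + b) f = (\<lambda>x. rep a f x + rep b f x)" by (rule ext) (rule rep_add)
    with add show ?case by (simp add: rep_add rep_arg_add algebra_simps)
  qed
qed (simp add: rep_add algebra_simps)

lemma rep_scale: "rep (Poly_Mapping.single 0 c * a) f y = c * rep a f y"
  by (simp add: rep_mult rep_single)

lemma fin_supp_rep [simp]:
  assumes "fin_supp f" shows "fin_supp (rep a f)"
proof (induction a rule: free_alg_induct)
  case (single w c)
  have "{y. rep (Poly_Mapping.single w c) f y \<noteq> 0} \<subseteq> (\<lambda>x. the (act w x)) ` {x. f x \<noteq> 0}"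
  proof
    fix y assume "y \<in> {y. rep (Poly_Mapping.single w c) f y \<noteq> 0}"
    then obtain x where "act (word_adj w) y = Some x" "f x \<noteq> 0"
      by (auto simp: rep_single split: option.splits)
    then show "y \<in> (\<lambda>x. the (act w x)) ` {x. f x \<noteq> 0}"
      by (intro image_eqI[of _ _ x]) (auto simp: act_adj)
  qed
  then show ?case using assms unfolding fin_supp_def by (meson finite_imageI finite_subset)
next
  case (add a b)
  have "rep (a + b) f = (\<lambda>x. rep a f x + rep b f x)" by (rule ext) (rule rep_add)
  with add show ?case by simp
qed

text \<open>For a word, both sides are the same double sum over the graph of its partial injection,
  read from the target or from the source.\<close>

lemma rep_adjoint:
  assumes f: "fin_supp f" and g: "fin_supp g"
  shows "ip (rep a f) g = ip f (rep (free_adj a) g)"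
proof (induction a rule: free_alg_induct)
  case (single w c)
  define F where "F = {x. f x \<noteq> 0}"
  define E where "E = {x. g x \<noteq> 0}"
  have fin: "finite F" "finite E" using f g by (simp_all add: F_def E_def fin_supp_def)
  \<comment> \<open>A pulled-back value becomes a sum over candidate preimages, at most one of which
    contributes. In this form the order of summation can be exchanged.\<close>
  have pull: "case_option 0 h (act (word_adj v) y) = (\<Sum>x\<in>K. if act v x = Some y then h x else 0)"
    if "finite K" "\<And>x. h x \<noteq> 0 \<Longrightarrow> x \<in> K" for h :: "'x \<Rightarrow> complex" and v y K
  proof (cases "act (word_adj v) y")
    case None
    then have "act v x \<noteq> Some y" for x using act_adj[of v y x] by simp
    then show ?thesis using None by simp
  next
    case (Some x)
    then have "act v x' = Some y \<longleftrightarrow> x' = x" for x' using act_adj[of v y x'] by auto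
    then show ?thesis using Some that by (auto simp: sum.delta)
  qed
  have "ip (rep (Poly_Mapping.single w c) f) g =
      (\<Sum>y\<in>E. rep (Poly_Mapping.single w c) f y * cnj (g y))"
    by (rule ip_superset) (use fin f in \<open>auto simp: E_def\<close>)
  also have "\<dots> = (\<Sum>y\<in>E. \<Sum>x\<in>F. if act w x = Some y then c * f x * cnj (g y) else 0)"
    using pull[OF fin(1), of f w]
    by (simp add: rep_single F_def sum_distrib_left sum_distrib_right if_distrib if_distribR cong: if_cong)
  also have "\<dots> = (\<Sum>x\<in>F. \<Sum>y\<in>E. if act w x = Some y then c * f x * cnj (g y) else 0)"
    by (rule sum.swap)
  also have "\<dots> = (\<Sum>x\<in>F. f x * cnj (rep (free_adj (Poly_Mapping.single w c)) g x))"
    using pull[OF fin(2), of g "word_adj w"]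
    by (simp add: rep_single E_def sum_distrib_left act_adj if_distrib mult.left_commute mult.assoc cong: if_cong)
  also have "\<dots> = ip f (rep (free_adj (Poly_Mapping.single w c)) g)"
    by (simp add: ip_def F_def)
  finally show ?case .
next
  case (add a b)
  \<comment> \<open>\<open>ip\<close> sums over the support of its first argument, which may differ
    between the three terms; the support of \<open>g\<close> is a common index set.\<close>
  have "ip (rep (a + b) f) g = ip (rep a f) g + ip (rep b f) g"
  proof -
    have fin: "finite {x. g x \<noteq> 0}" using g by (simp add: fin_supp_def)
    show ?thesis
      using ip_superset[OF fin, of "rep (a + b) f" g] ip_superset[OF fin, of "rep a f" g]
        ip_superset[OF fin, of "rep b f" g] f
      by (simp add: rep_add algebra_simps sum.distrib)
  qed
  with add show ?case
    by (simp add: free_adj_add ip_def rep_add algebra_simps sum.distrib)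
qed

text \<open>A word moves the values of \<open>f\<close> injectively and drops some of them, so it is
  a contraction; bounds add up under sums. This makes the supremum in \<open>opnorm\<close>
  finite.\<close>

lemma rep_bounded: "\<exists>C\<ge>0. \<forall>f. fin_supp f \<longrightarrow> l2 (rep a f) \<le> C * l2 f"
proof (induction a rule: free_alg_induct)
  case (single w c)
  have "l2 (rep (Poly_Mapping.single w c) f) \<le> cmod c * l2 f" if f: "fin_supp f" for f :: "'x \<Rightarrow> complex"
  proof -
    define h where "h y = case_option 0 f (act (word_adj w) y)" for y
    define k where "k y = the (act (word_adj w) y)" for y
    define H where "H = {y. h y \<noteq> 0}"
    have H: "act (word_adj w) y = Some (k y)" "h y = f (k y)" if "y \<in> H" for y
      using that by (auto simp: H_def h_def k_def split: option.splits)
    \<comment> \<open>On \<open>H\<close> the map \<open>k\<close> is a restriction of the inverse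
      of \<open>act w\<close>.\<close>
    have "inj_on k H" by (rule inj_onI) (metis H(1) act_adj option.inject)
    then have "(\<Sum>y\<in>H. (cmod (h y))\<^sup>2) = (\<Sum>x\<in>k ` H. (cmod (f x))\<^sup>2)"
      by (simp add: sum.reindex H(2))
    moreover have "k ` H \<subseteq> {x. f x \<noteq> 0}"
    proof (rule image_subsetI)
      show "k y \<in> {x. f x \<noteq> 0}" if "y \<in> H" for y
        using that H(2)[OF that] unfolding H_def by simp
    qed
    then have "(\<Sum>x\<in>k ` H. (cmod (f x))\<^sup>2) \<le> (\<Sum>x | f x \<noteq> 0. (cmod (f x))\<^sup>2)"
      by (intro sum_mono2) (use f in \<open>auto simp: fin_supp_def\<close>)
    ultimately have "l2 h \<le> l2 f" by (simp add: l2_def L2_set_def H_def)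
    moreover have "rep (Poly_Mapping.single w c) f = (\<lambda>y. c * h y)"
      by (rule ext) (simp add: rep_single h_def)
    moreover have "fin_supp h"
    proof -
      have "h = rep (Poly_Mapping.single w 1) f" by (rule ext) (simp add: rep_single h_def)
      then show ?thesis using f by simp
    qed
    ultimately show ?thesis by (simp add: l2_scale mult_left_mono)
  qed
  then show ?case by (intro exI[of _ "cmod c"]) simp
next
  case (add a b)
  then obtain C D where C: "C \<ge> 0" "\<And>f. fin_supp f \<Longrightarrow> l2 (rep a f) \<le> C * l2 f"
    and D: "D \<ge> 0" "\<And>f. fin_supp f \<Longrightarrow> l2 (rep b f) \<le> D * l2 f" by blast
  have "l2 (rep (a + b) f) \<le> (C + D) * l2 f" if f: "fin_supp f" for f
  proof -
    have "rep (a + b) f = (\<lambda>x. rep a f x + rep b f x)" by (rule ext) (rule rep_add)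
    then have "l2 (rep (a + b) f) \<le> l2 (rep a f) + l2 (rep b f)" using f by (simp add: l2_triangle)
    also have "\<dots> \<le> (C + D) * l2 f" using C(2)[OF f] D(2)[OF f] by (simp add: algebra_simps)
    finally show ?thesis .
  qed
  then show ?case using C(1) D(1) by (intro exI[of _ "C + D"]) simp
qed

section \<open>The operator seminorm\<close>

definition opnorm :: "'g free_alg \<Rightarrow> real" where
  "opnorm a = (SUP f\<in>{f. fin_supp f \<and> l2 f \<le> 1}. l2 (rep a f))"

lemma opnorm_least:
  assumes "\<And>f. fin_supp f \<Longrightarrow> l2 (rep a f) \<le> C * l2 f" "C \<ge> 0"
  shows "opnorm a \<le> C"
  unfolding opnorm_def
proof (rule cSUP_least)
  have "(\<lambda>x. 0) \<in> {f. fin_supp f \<and> l2 f \<le> 1}" by simp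
  then show "{f :: 'x \<Rightarrow> complex. fin_supp f \<and> l2 f \<le> 1} \<noteq> {}" by blast
  fix f :: "'x \<Rightarrow> complex" assume "f \<in> {f. fin_supp f \<and> l2 f \<le> 1}"
  then show "l2 (rep a f) \<le> C" using assms(1)[of f] mult_left_mono[of "l2 f" 1 C] assms(2) by simp
qed

lemma opnorm_unit:
  assumes f: "fin_supp f" "l2 f \<le> 1" shows "l2 (rep a f) \<le> opnorm a"
  unfolding opnorm_def
proof (rule cSUP_upper)
  obtain C where C: "C \<ge> 0" "\<And>f. fin_supp f \<Longrightarrow> l2 (rep a f) \<le> C * l2 f"
    using rep_bounded by blast
  show "bdd_above ((\<lambda>f. l2 (rep a f)) ` {f. fin_supp f \<and> l2 f \<le> 1})"
  proof (rule bdd_aboveI2[where M = C])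
    fix f :: "'x \<Rightarrow> complex" assume "f \<in> {f. fin_supp f \<and> l2 f \<le> 1}"
    then show "l2 (rep a f) \<le> C" using C(2)[of f] mult_left_mono[of "l2 f" 1 C] C(1) by simp
  qed
qed (use f in simp)

lemma opnorm_nonneg: "0 \<le> opnorm a"
  using opnorm_unit[of "\<lambda>x. 0" a] l2_nonneg[of "rep a (\<lambda>x. 0)"] by (simp del: l2_nonneg)

lemma opnorm_upper:
  assumes f: "fin_supp f" shows "l2 (rep a f) \<le> opnorm a * l2 f"
proof (cases "l2 f = 0")
  case True
  then have "f = (\<lambda>x. 0)" using l2_eq_0[OF f] by blast
  then have "rep a f = (\<lambda>x. 0)" using rep_arg_scale[of a 0 f] by auto
  then show ?thesis using True by simp
next
  case False
  then have pos: "l2 f > 0" by (simp add: less_le)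
  define c where "c = complex_of_real (1 / l2 f)"
  have c: "cmod c = 1 / l2 f" using pos by (simp add: c_def norm_divide)
  have "rep a (\<lambda>x. c * f x) = (\<lambda>y. c * rep a f y)" by (rule ext) (rule rep_arg_scale)
  then have "l2 (rep a f) / l2 f = l2 (rep a (\<lambda>x. c * f x))" using f c by (simp add: l2_scale)
  also have "\<dots> \<le> opnorm a" by (rule opnorm_unit) (use f c pos in \<open>simp_all add: l2_scale\<close>)
  finally show ?thesis using pos by (simp add: field_simps)
qed

text \<open>The bridge between the seminorm and calculation: both the relations and the failure of
  \<open>R^2\<close> are tested through this pointwise criterion.\<close>

lemma opnorm_eq_0:
  fixes a :: "'g free_alg"
  shows "opnorm a = 0 \<longleftrightarrow> (\<forall>f. fin_supp f \<longrightarrow> (\<forall>x. rep a f x = 0))"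
proof (intro iffI allI impI)
  fix f :: "'x \<Rightarrow> complex" and x assume "opnorm a = 0" "fin_supp f"
  then show "rep a f x = 0"
    using opnorm_upper[of f a] l2_nonneg[of "rep a f"] by (intro l2_eq_0[of "rep a f"]) auto
next
  assume *: "\<forall>f. fin_supp f \<longrightarrow> (\<forall>x. rep a f x = 0)"
  have "opnorm a \<le> 0" by (rule opnorm_least) (use * in \<open>auto simp: l2_def\<close>)
  then show "opnorm a = 0" using opnorm_nonneg[of a] by simp
qed

lemma opnorm_mult: "opnorm (a * b) \<le> opnorm a * opnorm b"
proof (rule opnorm_least)
  fix f :: "'x \<Rightarrow> complex" assume f: "fin_supp f"
  have "rep (a * b) f = rep a (rep b f)" by (rule ext) (rule rep_mult)
  then have "l2 (rep (a * b) f) \<le> opnorm a * l2 (rep b f)" using f by (simp add: opnorm_upper)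
  also have "\<dots> \<le> opnorm a * (opnorm b * l2 f)"
    using f by (intro mult_left_mono opnorm_upper opnorm_nonneg)
  finally show "l2 (rep (a * b) f) \<le> opnorm a * opnorm b * l2 f" by (simp add: mult.assoc)
qed (simp add: opnorm_nonneg)

text \<open>The Hilbert space argument: the square of the norm of \<open>a f\<close> is the inner
  product of \<open>f\<close> with \<open>a^* a f\<close>, and Cauchy-Schwarz bounds the
  latter.\<close>

lemma opnorm_square_le: "(opnorm a)\<^sup>2 \<le> opnorm (free_adj a * a)"
proof -
  have "opnorm a \<le> sqrt (opnorm (free_adj a * a))"
  proof (rule opnorm_least)
    fix f :: "'x \<Rightarrow> complex" assume f: "fin_supp f"
    have eq: "rep (free_adj a) (rep a f) = rep (free_adj a * a) f"
      by (rule ext) (simp add: rep_mult)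
    have "of_real ((l2 (rep a f))\<^sup>2) = ip f (rep (free_adj a * a) f)"
      using rep_adjoint[OF f, of "rep a f" a] f by (simp only: ip_self eq fin_supp_rep)
    then have "(l2 (rep a f))\<^sup>2 = cmod (ip f (rep (free_adj a * a) f))"
      by (metis norm_of_real abs_of_nonneg zero_le_power2)
    also have "\<dots> \<le> l2 f * l2 (rep (free_adj a * a) f)"
      using f by (simp add: ip_cauchy_schwarz)
    also have "\<dots> \<le> l2 f * (opnorm (free_adj a * a) * l2 f)"
      using f by (intro mult_left_mono opnorm_upper) simp_all
    also have "\<dots> = (sqrt (opnorm (free_adj a * a)) * l2 f)\<^sup>2"
      by (simp add: power_mult_distrib opnorm_nonneg) (simp add: power2_eq_square)
    finally show "l2 (rep a f) \<le> sqrt (opnorm (free_adj a * a)) * l2 f"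
      by (rule power2_le_imp_le) (simp add: opnorm_nonneg)
  qed (simp add: opnorm_nonneg)
  then have "(opnorm a)\<^sup>2 \<le> (sqrt (opnorm (free_adj a * a)))\<^sup>2"
    by (intro power_mono opnorm_nonneg)
  then show ?thesis by (simp add: opnorm_nonneg)
qed

lemma cstar_seminorm_opnorm: "cstar_seminorm (free_star_algebra G) opnorm"
  unfolding cstar_seminorm_def
proof (intro conjI ballI allI)
  fix a b :: "'g free_alg"
  have "opnorm (a + b) \<le> opnorm a + opnorm b"
  proof (rule opnorm_least)
    fix f :: "'x \<Rightarrow> complex" assume f: "fin_supp f"
    have "rep (a + b) f = (\<lambda>x. rep a f x + rep b f x)" by (rule ext) (rule rep_add)
    then have "l2 (rep (a + b) f) \<le> l2 (rep a f) + l2 (rep b f)" using f by (simp add: l2_triangle)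
    also have "\<dots> \<le> (opnorm a + opnorm b) * l2 f"
      using opnorm_upper[OF f, of a] opnorm_upper[OF f, of b] by (simp add: algebra_simps)
    finally show "l2 (rep (a + b) f) \<le> (opnorm a + opnorm b) * l2 f" .
  qed (simp add: opnorm_nonneg)
  then show "opnorm (a \<oplus>\<^bsub>free_star_algebra G\<^esub> b) \<le> opnorm a + opnorm b" by simp
  show "opnorm (a \<otimes>\<^bsub>free_star_algebra G\<^esub> b) \<le> opnorm a * opnorm b" by (simp add: opnorm_mult)
  fix c
  have sc: "rep (Poly_Mapping.single 0 c * a) f = (\<lambda>x. c * rep a f x)" for f
    by (rule ext) (rule rep_scale)
  have "opnorm (Poly_Mapping.single 0 c * a) \<le> cmod c * opnorm a"
    by (rule opnorm_least)
      (simp_all add: sc l2_scale opnorm_upper mult_left_mono opnorm_nonneg mult.assoc)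
  moreover have "cmod c * opnorm a \<le> opnorm (Poly_Mapping.single 0 c * a)"
  proof (cases "c = 0")
    case False
    have "opnorm a \<le> opnorm (Poly_Mapping.single 0 c * a) / cmod c"
    proof (rule opnorm_least)
      fix f :: "'x \<Rightarrow> complex" assume f: "fin_supp f"
      show "l2 (rep a f) \<le> opnorm (Poly_Mapping.single 0 c * a) / cmod c * l2 f"
        using opnorm_upper[OF f, of "Poly_Mapping.single 0 c * a"] f False
        by (simp add: sc l2_scale field_simps)
    qed (simp add: opnorm_nonneg)
    then show ?thesis using False by (simp add: field_simps)
  qed (simp add: opnorm_nonneg)
  ultimately show "opnorm (c \<odot>\<^bsub>free_star_algebra G\<^esub> a) = cmod c * opnorm a" by simp
  \<comment> \<open>The square of the norm of \<open>b\<close> is at most the norm of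
    \<open>b^* b\<close>, hence at most the product of the norms of \<open>b^*\<close> and
    \<open>b\<close>; then cancel. Used for \<open>a\<close> and for its adjoint, this makes the
    adjoint isometric and yields the remaining upper bound on the norm of
    \<open>a^* a\<close>.\<close>
  have le: "opnorm b \<le> opnorm (free_adj b)" for b
  proof (cases "opnorm b = 0")
    case False
    then have "opnorm b > 0" using opnorm_nonneg[of b] by simp
    moreover have "opnorm b * opnorm b \<le> opnorm (free_adj b) * opnorm b"
      using opnorm_square_le[of b] opnorm_mult[of "free_adj b" b] by (simp add: power2_eq_square)
    ultimately show ?thesis by simp
  qed (simp add: opnorm_nonneg)
  have "opnorm (free_adj a) = opnorm a" using le[of a] le[of "free_adj a"] by simp
  then have "opnorm (free_adj a * a) \<le> (opnorm a)\<^sup>2"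
    using opnorm_mult[of "free_adj a" a] by (simp add: power2_eq_square)
  then show "opnorm (adj (free_star_algebra G) a \<otimes>\<^bsub>free_star_algebra G\<^esub> a) = (opnorm a)\<^sup>2"
    using opnorm_square_le[of a] by simp
qed (rule opnorm_nonneg)

text \<open>A partial injection followed by its inverse and then by itself is itself. This serves
  twice: for the relations saying that generators are partial isometries, and for the generators of
  \<open>J\<close>.\<close>

lemma opnorm_word_partial_isometry:
  "opnorm (Poly_Mapping.single w 1 * free_adj (Poly_Mapping.single w 1) * Poly_Mapping.single w 1
     - Poly_Mapping.single w 1) = 0"
proof -
  have "act (word_adj w + (w + word_adj w)) y = act (word_adj w) y" for y
  proof (cases "act (word_adj w) y")
    case (Some x)
    then have "act w x = Some y" by (simp add: act_adj)
    with Some show ?thesis by (simp add: act_plus)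
  qed (simp add: act_plus)
  then show ?thesis
    by (simp add: opnorm_eq_0 rep_minus mult_single rep_single word_adj_plus)
qed

end


section \<open>A representation on two copies of the integers\<close>

text \<open>
  Acting on \<open>int + int\<close>: the left copy carries the projection \<open>p\<close>, the right copy \<open>q\<close>. The flag
  marks the adjoint, as in \<^typ>\<open>'g word\<close>.
\<close>

fun affine_act :: "int \<Rightarrow> int \<Rightarrow> int \<Rightarrow> bool \<Rightarrow> int + int \<Rightarrow> (int + int) option" where
  "affine_act N c i False (Inr x) = (if 1 \<le> i \<and> i \<le> N then Some (Inl (N * x + (i - 1) + c)) else None)"
| "affine_act N c i True (Inl z) =
     (if 1 \<le> i \<and> i \<le> N \<and> (z - c) mod N = i - 1 then Some (Inr ((z - c) div N)) else None)"
| "affine_act N c i False (Inl z) = None"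
| "affine_act N c i True (Inr x) = None"

text \<open>
  Without the offset \<open>1\<close> in the action of the \<open>t\<^sub>j\<close>, the operator \<open>T\<^sup>*S\<close> would be a partial isometry
  whenever \<open>n\<close> divides \<open>m\<close> or \<open>m\<close> divides \<open>n\<close>.
\<close>

fun gen_act :: "nat \<Rightarrow> nat \<Rightarrow> gen \<times> bool \<Rightarrow> int + int \<Rightarrow> (int + int) option" where
  "gen_act n m (GenS i, b) = affine_act (int n) 0 (int i) b"
| "gen_act n m (GenT j, b) = affine_act (int m) 1 (int j) b"

text \<open>Division of \<open>z - c\<close> by \<open>N\<close> with remainder \<open>i - 1\<close>
  determines \<open>u\<close>. Because an index outside 1 to \<open>N\<close> acts nowhere, the law
  holds for every letter, as \<open>partial_action\<close> demands.\<close>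

lemma affine_act_inverse:
  "affine_act N c i b x = Some y \<longleftrightarrow> affine_act N c i (\<not> b) y = Some x"
proof -
  have *: "affine_act N c i False x = Some y \<longleftrightarrow> affine_act N c i True y = Some x" for x y
  proof (cases x; cases y)
    fix u z assume xy: "x = Inr u" "y = Inl z"
    show ?thesis
    proof (cases "1 \<le> i \<and> i \<le> N")
      case True
      have "z = N * u + (i - 1) + c \<longleftrightarrow> (z - c) mod N = i - 1 \<and> (z - c) div N = u"
      proof
        assume "z = N * u + (i - 1) + c"
        then have "z - c = (i - 1) + N * u" by simp
        with True show "(z - c) mod N = i - 1 \<and> (z - c) div N = u" by simp
      next
        assume "(z - c) mod N = i - 1 \<and> (z - c) div N = u"
        then show "z = N * u + (i - 1) + c" using mult_div_mod_eq[of N "z - c"] by auto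
      qed
      with True show ?thesis by (auto simp: xy)
    qed (auto simp: xy)
  qed auto
  show ?thesis using *[of x y] *[of y x] by (cases b) auto
qed

lemma affine_div_mod:
  assumes "1 \<le> i" "i \<le> (N::int)"
  shows "(N * x + i - 1) mod N = i - 1" "(N * x + i - 1) div N = x"
proof -
  have "N * x + i - 1 = (i - 1) + N * x" by simp
  with assms show "(N * x + i - 1) mod N = i - 1" "(N * x + i - 1) div N = x"
    by (simp_all only: mod_mult_self2 div_mult_self2) simp_all
qed

lemma affine_round_trip: "z mod N = i - 1 \<Longrightarrow> N * (z div N) + (i - 1) = (z::int)"
  using mult_div_mod_eq[of N z] by simp

text \<open>Residues run from 0 to \<open>N - 1\<close> while indices run from 1 to
  \<open>N\<close>, so exactly one index survives, the residue plus 1.\<close>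

lemma sum_residue:
  assumes "N \<ge> (1::nat)"
  shows "(\<Sum>i\<in>{1..N}. if z mod int N = int i - 1 then f i else 0) = f (nat (z mod int N) + 1)"
proof -
  define r where "r = z mod int N"
  have r: "0 \<le> r" "r < int N" using assms by (simp_all add: r_def)
  then have "r = int i - 1 \<longleftrightarrow> i = nat r + 1" for i by auto
  moreover have "Suc (nat r) \<le> N" using r by linarith
  ultimately show ?thesis by (simp add: sum.delta flip: r_def)
qed

global_interpretation gen_action: partial_action "gen_act n m" for n m
proof
  show "gen_act n m (g, b) x = Some y \<longleftrightarrow> gen_act n m (g, \<not> b) y = Some x" for g b x y
    by (cases g) (simp_all add: affine_act_inverse[of _ _ _ b])
qed

text \<open>The flag is opposite to that of the letter because \<open>rep\<close> pulls back along
  the adjoint word.\<close>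

lemma rep_gen: "gen_action.rep n m (free_gen g) f y = case_option 0 f (gen_act n m (g, True) y)"
  by (simp add: free_gen_def gen_action.rep_single gen_action.act_def word_adj_def)

lemma rep_gen_adj:
  "gen_action.rep n m (free_adj (free_gen g)) f y = case_option 0 f (gen_act n m (g, False) y)"
  by (simp add: free_gen_def gen_action.rep_single gen_action.act_def word_adj_def)

section \<open>The defining relations in the representation\<close>

text \<open>The range of each \<open>s_i\<close> is a residue class modulo \<open>n\<close>, and
  these classes partition the left copy; the sum of the range projections is therefore the
  projection onto that copy.\<close>

lemma rep_range_S:
  assumes "n \<ge> 1"
  shows "gen_action.rep n m (\<Sum>i\<in>{1..n}. free_gen (GenS i) * free_adj (free_gen (GenS i))) f =
    case_sum (f \<circ> Inl) (\<lambda>_. 0)"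
proof
  fix y
  have "gen_action.rep n m (\<Sum>i\<in>{1..n}. free_gen (GenS i) * free_adj (free_gen (GenS i))) f (Inl z) =
      (\<Sum>i\<in>{1..n}. if z mod int n = int i - 1 then f (Inl z) else 0)" for z
    unfolding gen_action.rep_sum
  proof (rule sum.cong[OF refl])
    fix i assume "i \<in> {1..n}"
    then show "gen_action.rep n m (free_gen (GenS i) * free_adj (free_gen (GenS i))) f (Inl z) =
        (if z mod int n = int i - 1 then f (Inl z) else 0)"
      using affine_round_trip[of "z" "int n" "int i"]
      by (simp add: gen_action.rep_mult rep_gen rep_gen_adj)
  qed
  then show "gen_action.rep n m (\<Sum>i\<in>{1..n}. free_gen (GenS i) * free_adj (free_gen (GenS i))) f y =
    case_sum (f \<circ> Inl) (\<lambda>_. 0) y"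
    by (cases y) (simp_all only: sum_residue[OF assms], simp_all add: gen_action.rep_sum gen_action.rep_mult rep_gen)
qed

text \<open>The shift by 1 only relabels the residue classes modulo \<open>m\<close>, which still
  partition the left copy.\<close>

lemma rep_range_T:
  assumes "m \<ge> 1"
  shows "gen_action.rep n m (\<Sum>j\<in>{1..m}. free_gen (GenT j) * free_adj (free_gen (GenT j))) f =
    case_sum (f \<circ> Inl) (\<lambda>_. 0)"
proof
  fix y
  have "gen_action.rep n m (\<Sum>j\<in>{1..m}. free_gen (GenT j) * free_adj (free_gen (GenT j))) f (Inl z) =
      (\<Sum>j\<in>{1..m}. if (z - 1) mod int m = int j - 1 then f (Inl z) else 0)" for z
    unfolding gen_action.rep_sum
  proof (rule sum.cong[OF refl])
    fix i assume "i \<in> {1..m}"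
    then show "gen_action.rep n m (free_gen (GenT i) * free_adj (free_gen (GenT i))) f (Inl z) =
        (if (z - 1) mod int m = int i - 1 then f (Inl z) else 0)"
      using affine_round_trip[of "z - 1" "int m" "int i"]
      by (simp add: gen_action.rep_mult rep_gen rep_gen_adj)
  qed
  then show "gen_action.rep n m (\<Sum>j\<in>{1..m}. free_gen (GenT j) * free_adj (free_gen (GenT j))) f y =
    case_sum (f \<circ> Inl) (\<lambda>_. 0) y"
    by (cases y) (simp_all only: sum_residue[OF assms], simp_all add: gen_action.rep_sum gen_action.rep_mult rep_gen)
qed

text \<open>Each \<open>s_i\<close> is defined on the whole right copy, whatever the index, so the
  source projection is the one onto the right copy.\<close>

lemma rep_source_S:
  assumes "i \<in> {1..n}"
  shows "gen_action.rep n m (free_adj (free_gen (GenS i)) * free_gen (GenS i)) f =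
    case_sum (\<lambda>_. 0) (f \<circ> Inr)"
proof
  show "gen_action.rep n m (free_adj (free_gen (GenS i)) * free_gen (GenS i)) f y =
    case_sum (\<lambda>_. 0) (f \<circ> Inr) y" for y
    using assms by (cases y) (simp_all add: gen_action.rep_mult rep_gen rep_gen_adj affine_div_mod)
qed

lemma rep_source_T:
  assumes "j \<in> {1..m}"
  shows "gen_action.rep n m (free_adj (free_gen (GenT j)) * free_gen (GenT j)) f =
    case_sum (\<lambda>_. 0) (f \<circ> Inr)"
proof
  show "gen_action.rep n m (free_adj (free_gen (GenT j)) * free_gen (GenT j)) f y =
    case_sum (\<lambda>_. 0) (f \<circ> Inr) y" for y
    using assms by (cases y) (simp_all add: gen_action.rep_mult rep_gen rep_gen_adj affine_div_mod)
qed

text \<open>Distinct indices belong to distinct residues, so the ranges are disjoint.\<close>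

lemma rep_orthogonal:
  assumes "i \<noteq> k"
  shows "gen_action.rep n m (free_adj (free_gen (GenS i)) * free_gen (GenS k)) f y = 0"
    and "gen_action.rep n m (free_adj (free_gen (GenT i)) * free_gen (GenT k)) f y = 0"
  using assms by (cases y; simp add: gen_action.rep_mult rep_gen rep_gen_adj affine_div_mod)+

text \<open>Makes \<open>opnorm\<close> one of the seminorms over which the universal seminorm is
  the supremum. With \<open>p\<close> and \<open>q\<close> acting as the projections onto the left
  and right copy, \<open>pq = 0\<close> and \<open>p + q = 1\<close> are visible pointwise.\<close>

lemma opnorm_L_rels:
  assumes nm: "n \<ge> 1" "m \<ge> 1" and r: "r \<in> L_rels n m"
  shows "gen_action.opnorm n m r = 0"
proof -
  define p where "p = (\<Sum>i\<in>{1..n}. free_gen (GenS i) * free_adj (free_gen (GenS i)))"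
  have zero: "gen_action.opnorm n m a = 0" if "\<And>f y. gen_action.rep n m a f y = 0" for a
    using that by (simp add: gen_action.opnorm_eq_0)
  have iso: "gen_action.opnorm n m (free_gen g * free_adj (free_gen g) * free_gen g - free_gen g) = 0"
    for g
    unfolding free_gen_def by (rule gen_action.opnorm_word_partial_isometry)
  note rep_simps = gen_action.rep_minus gen_action.rep_add gen_action.rep_one
    rep_range_S[OF nm(1), folded p_def] rep_range_T[OF nm(2)] rep_source_S rep_source_T
  \<comment> \<open>The families for \<open>s_i\<close> and \<open>t_j\<close> expressing that
    generators are partial isometries are merged into the first case.\<close>
  consider g where "r = free_gen g * free_adj (free_gen g) * free_gen g - free_gen g"
    | i k where "i \<noteq> k" "r = free_adj (free_gen (GenS i)) * free_gen (GenS k)"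
    | i k where "i \<noteq> k" "r = free_adj (free_gen (GenT i)) * free_gen (GenT k)"
    | i j where "i \<in> {1..n}" "j \<in> {1..m}"
        "r = free_adj (free_gen (GenS i)) * free_gen (GenS i) - free_adj (free_gen (GenT j)) * free_gen (GenT j)"
    | "r = p - (\<Sum>j\<in>{1..m}. free_gen (GenT j) * free_adj (free_gen (GenT j)))"
    | i where "i \<in> {1..n}" "r = p * (free_adj (free_gen (GenS i)) * free_gen (GenS i))"
    | i where "i \<in> {1..n}" "r = p + free_adj (free_gen (GenS i)) * free_gen (GenS i) - 1"
    using r unfolding L_rels_def Let_def p_def[symmetric] by blast
  then show ?thesis
  proof cases
    case 1
    then show ?thesis by (simp add: iso)
  next
    case 2
    then show ?thesis by (simp add: zero rep_orthogonal)
  next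
    case 3
    then show ?thesis by (simp add: zero rep_orthogonal)
  next
    case 4
    then show ?thesis by (intro zero) (simp add: rep_simps)
  next
    case 5
    then show ?thesis by (intro zero) (simp add: rep_simps del: One_nat_def)
  next
    case 6
    have "gen_action.rep n m r f y = 0" for f y
      unfolding 6(2) gen_action.rep_mult[of n m p] rep_simps(4) rep_source_S[OF 6(1)]
      by (cases y) simp_all
    then show ?thesis by (rule zero)
  next
    case 7
    have "gen_action.rep n m r f y = 0" for f y
      by (cases y) (simp_all add: 7(2) rep_simps(1-4) rep_source_S[OF 7(1)])
    then show ?thesis by (rule zero)
  qed
qed

section \<open>The averages \<open>S\<close> and \<open>T\<close> in the representation\<close>

definition inv_sqrt :: "nat \<Rightarrow> complex" where
  "inv_sqrt N = complex_of_real (1 / sqrt (real N))"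

lemma inv_sqrt_mult:
  assumes "N \<ge> 1" shows "inv_sqrt N * (inv_sqrt N * (of_nat N * z)) = z"
proof -
  have "inv_sqrt N * (inv_sqrt N * (of_nat N * z)) =
      of_real (1 / sqrt (real N) * (1 / sqrt (real N)) * real N) * z"
    unfolding inv_sqrt_def by (simp only: of_real_mult of_real_of_nat_eq mult.assoc)
  also have "1 / sqrt (real N) * (1 / sqrt (real N)) * real N = 1" using assms by simp
  finally show ?thesis by simp
qed

lemma cnj_inv_sqrt [simp]: "cnj (inv_sqrt N) = inv_sqrt N"
  by (simp add: inv_sqrt_def)

text \<open>Lifts of \<open>S\<close> and \<open>T\<close> to the free algebra are
  \<open>avg GenS n\<close> and \<open>avg GenT m\<close>.\<close>

definition avg :: "(nat \<Rightarrow> 'g) \<Rightarrow> nat \<Rightarrow> 'g free_alg" where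
  "avg G N = Poly_Mapping.single 0 (inv_sqrt N) * (\<Sum>i\<in>{1..N}. free_gen (G i))"

lemma rep_avg:
  "gen_action.rep n m (avg G N) f y = inv_sqrt N *
     (\<Sum>i\<in>{1..N}. case_option 0 f (gen_act n m (G i, True) y))"
  by (simp add: avg_def gen_action.rep_scale gen_action.rep_sum rep_gen)

lemma rep_avg_adj:
  "gen_action.rep n m (free_adj (avg G N)) f y = inv_sqrt N *
     (\<Sum>i\<in>{1..N}. case_option 0 f (gen_act n m (G i, False) y))"
proof -
  have "gen_action.rep n m (Poly_Mapping.single 0 (inv_sqrt N)) f = (\<lambda>x. inv_sqrt N * f x)"
    by (rule ext) (simp add: gen_action.rep_single)
  then show ?thesis
    by (simp add: avg_def free_adj_mult free_adj_sum gen_action.rep_mult gen_action.rep_arg_scale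
        gen_action.rep_sum rep_gen_adj)
qed

text \<open>Only the index given by the residue of \<open>z\<close> contributes, so up to the scalar
  \<open>S\<close> is the pullback along \<open>z div n\<close>. For \<open>T\<close> the offset
  turns this into \<open>(z - 1) div m\<close>.\<close>

lemma rep_avg_S:
  assumes "n \<ge> 1"
  shows "gen_action.rep n m (avg GenS n) f =
    case_sum (\<lambda>z. inv_sqrt n * f (Inr (z div int n))) (\<lambda>_. 0)"
proof
  show "gen_action.rep n m (avg GenS n) f y =
      case_sum (\<lambda>z. inv_sqrt n * f (Inr (z div int n))) (\<lambda>_. 0) y" for y
  proof (cases y)
    case (Inl z)
    have "(\<Sum>i\<in>{1..n}. case_option 0 f (gen_act n m (GenS i, True) (Inl z))) =
        (\<Sum>i\<in>{1..n}. if z mod int n = int i - 1 then f (Inr (z div int n)) else 0)"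
      by (rule sum.cong) auto
    then show ?thesis using Inl by (simp only: rep_avg sum_residue[OF assms]) simp
  qed (simp add: rep_avg)
qed

lemma rep_avg_T:
  assumes "m \<ge> 1"
  shows "gen_action.rep n m (avg GenT m) f =
    case_sum (\<lambda>z. inv_sqrt m * f (Inr ((z - 1) div int m))) (\<lambda>_. 0)"
proof
  show "gen_action.rep n m (avg GenT m) f y =
      case_sum (\<lambda>z. inv_sqrt m * f (Inr ((z - 1) div int m))) (\<lambda>_. 0) y" for y
  proof (cases y)
    case (Inl z)
    have "(\<Sum>i\<in>{1..m}. case_option 0 f (gen_act n m (GenT i, True) (Inl z))) =
        (\<Sum>i\<in>{1..m}. if (z - 1) mod int m = int i - 1 then f (Inr ((z - 1) div int m)) else 0)"
      by (rule sum.cong) auto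
    then show ?thesis using Inl by (simp only: rep_avg sum_residue[OF assms]) simp
  qed (simp add: rep_avg)
qed

lemma rep_avg_S_adj:
  "gen_action.rep n m (free_adj (avg GenS n)) f =
    case_sum (\<lambda>_. 0) (\<lambda>x. inv_sqrt n * (\<Sum>i\<in>{1..n}. f (Inl (int n * x + int i - 1))))"
proof
  have "(\<Sum>i\<in>{1..n}. case_option 0 f (gen_act n m (GenS i, False) (Inr x))) =
      (\<Sum>i\<in>{1..n}. f (Inl (int n * x + int i - 1)))" for x
    by (rule sum.cong) (auto simp: add_diff_eq)
  then show "gen_action.rep n m (free_adj (avg GenS n)) f y =
    case_sum (\<lambda>_. 0) (\<lambda>x. inv_sqrt n * (\<Sum>i\<in>{1..n}. f (Inl (int n * x + int i - 1)))) y" for y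
    by (cases y) (simp_all only: rep_avg_adj, simp_all)
qed

text \<open>The adjoint sums over a block of \<open>m\<close> consecutive integers. The offset 1
  cancels the \<open>- 1\<close> in \<open>affine_act\<close>, so the block for \<open>x\<close>
  starts at \<open>m x + 1\<close>.\<close>

lemma rep_avg_T_adj:
  "gen_action.rep n m (free_adj (avg GenT m)) f =
    case_sum (\<lambda>_. 0) (\<lambda>x. inv_sqrt m * (\<Sum>j\<in>{1..m}. f (Inl (int m * x + int j))))"
proof
  have "(\<Sum>i\<in>{1..m}. case_option 0 f (gen_act n m (GenT i, False) (Inr x))) =
      (\<Sum>j\<in>{1..m}. f (Inl (int m * x + int j)))" for x
    by (rule sum.cong) auto
  then show "gen_action.rep n m (free_adj (avg GenT m)) f y =
    case_sum (\<lambda>_. 0) (\<lambda>x. inv_sqrt m * (\<Sum>j\<in>{1..m}. f (Inl (int m * x + int j)))) y" for y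
    by (cases y) (simp_all only: rep_avg_adj, simp_all)
qed

text \<open>A function pulled back from the quotient is constant on each block, so summing over the
  block multiplies by its length and the two scalars cancel. Both products are thus the projection
  \<open>q\<close>.\<close>

lemma rep_avg_isometry:
  assumes "n \<ge> 1" "m \<ge> 1"
  shows "gen_action.rep n m (free_adj (avg GenS n)) (gen_action.rep n m (avg GenS n) f) = case_sum (\<lambda>_. 0) (f \<circ> Inr)"
    and "gen_action.rep n m (free_adj (avg GenT m)) (gen_action.rep n m (avg GenT m) f) = case_sum (\<lambda>_. 0) (f \<circ> Inr)"
proof -
  have S: "(\<Sum>i\<in>{1..n}. f (Inr ((int n * x + int i - 1) div int n))) = of_nat n * f (Inr x)" for x
  proof -
    have "(\<Sum>i\<in>{1..n}. f (Inr ((int n * x + int i - 1) div int n))) = (\<Sum>i\<in>{1..n}. f (Inr x))"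
      by (rule sum.cong) (auto simp: affine_div_mod)
    then show ?thesis by simp
  qed
  show "gen_action.rep n m (free_adj (avg GenS n)) (gen_action.rep n m (avg GenS n) f) = case_sum (\<lambda>_. 0) (f \<circ> Inr)"
    unfolding rep_avg_S_adj rep_avg_S[OF assms(1)]
    by (rule ext) (simp add: S inv_sqrt_mult[OF assms(1)] del: One_nat_def flip: sum_distrib_left split: sum.split)
  have T: "(\<Sum>j\<in>{1..m}. f (Inr ((int m * x + int j - 1) div int m))) = of_nat m * f (Inr x)" for x
  proof -
    have "(\<Sum>j\<in>{1..m}. f (Inr ((int m * x + int j - 1) div int m))) = (\<Sum>j\<in>{1..m}. f (Inr x))"
      by (rule sum.cong) (auto simp: affine_div_mod)
    then show ?thesis by simp
  qed
  show "gen_action.rep n m (free_adj (avg GenT m)) (gen_action.rep n m (avg GenT m) f) = case_sum (\<lambda>_. 0) (f \<circ> Inr)"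
    unfolding rep_avg_T_adj rep_avg_T[OF assms(2)]
    by (rule ext) (simp add: T inv_sqrt_mult[OF assms(2)] del: One_nat_def flip: sum_distrib_left split: sum.split)
qed

text \<open>With \<open>S^* S = T^* T = q\<close>, the defect applied to \<open>T e\<close> equals
  \<open>S W W^* W e - S W e\<close>, and a further \<open>S^*\<close> removes the leading
  \<open>S\<close>. In the graph, the vertices of both sides are points of the right copy and the
  edges are points of the left copy.\<close>

lemma opnorm_square_defect:
  assumes "n \<ge> 2" "m \<ge> 2" and a: "a = avg GenS n * free_adj (avg GenT m)"
  shows "gen_action.opnorm n m (a * a * free_adj (a * a) * (a * a) - a * a) \<noteq> 0"
proof
  assume 0: "gen_action.opnorm n m (a * a * free_adj (a * a) * (a * a) - a * a) = 0"
  have nm: "n \<ge> 1" "m \<ge> 1" using assms by simp_all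
  define P where "P = gen_action.rep n m (avg GenS n)"
  define P' where "P' = gen_action.rep n m (free_adj (avg GenS n))"
  define Q where "Q = gen_action.rep n m (avg GenT m)"
  define Q' where "Q' = gen_action.rep n m (free_adj (avg GenT m))"
  define \<kappa> where "\<kappa> = inv_sqrt n * inv_sqrt m"
  have \<kappa>: "\<kappa> \<noteq> 0" using nm by (simp add: \<kappa>_def inv_sqrt_def)
  \<comment> \<open>The indicator of the left vertex -1. Writing it through \<open>of_nat\<close>
    turns all later sums into natural-number counts, where positivity is available.\<close>
  define e :: "int + int \<Rightarrow> complex" where "e = (\<lambda>x. of_nat (case_sum (\<lambda>_. 0) (\<lambda>x. if x = - 1 then 1 else 0) x))"
  define d where "d = a * a * free_adj (a * a) * (a * a) - a * a"
  have proj: "P' (P f) = case_sum (\<lambda>_. 0) (f \<circ> Inr)" "Q' (Q f) = case_sum (\<lambda>_. 0) (f \<circ> Inr)"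
      "P (case_sum (\<lambda>_. 0) (f \<circ> Inr)) = P f" "Q (case_sum (\<lambda>_. 0) (f \<circ> Inr)) = Q f" for f
    unfolding P_def P'_def Q_def Q'_def rep_avg_isometry[OF nm]
    by (simp_all add: rep_avg_S[OF nm(1)] rep_avg_T[OF nm(2)])
  have "x = Inr (- 1)" if "e x \<noteq> 0" for x
    using that by (cases x) (auto simp: e_def split: if_splits)
  then have "{x. e x \<noteq> 0} \<subseteq> {Inr (- 1)}" by blast
  then have "fin_supp e" unfolding fin_supp_def by (rule finite_subset) simp
  then have "fin_supp (Q e)" by (simp add: Q_def)
  \<comment> \<open>The test vector is \<open>T e\<close> because \<open>a * a\<close> ends in
    \<open>T^*\<close>, and \<open>T^* T\<close> fixes \<open>e\<close>.\<close>
  with 0 have "gen_action.rep n m d (Q e) = (\<lambda>_. 0)"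
    by (auto simp: gen_action.opnorm_eq_0 d_def)
  moreover have "P' (\<lambda>_. 0) = (\<lambda>_. 0)"
    by (rule ext) (simp add: P'_def rep_avg_S_adj split: sum.split)
  ultimately have "P' (gen_action.rep n m d (Q e)) = (\<lambda>_. 0)" by simp
  moreover have rep_mult: "gen_action.rep n m (b * c) f = gen_action.rep n m b (gen_action.rep n m c f)"
    for b c f by (rule ext) (rule gen_action.rep_mult)
  have "gen_action.rep n m d (Q e) = (\<lambda>x. P (Q' (P (P' (Q (Q' (P e)))))) x - P (Q' (P e)) x)"
    by (rule ext)
      (simp add: d_def a gen_action.rep_minus free_adj_mult rep_mult proj
        flip: P_def P'_def Q_def Q'_def)
  moreover have "(\<lambda>x. P f x - P g x) = P (\<lambda>x. f x - g x)" for f g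
    by (rule ext) (simp add: P_def rep_avg_S[OF nm(1)] right_diff_distrib split: sum.split)
  ultimately have "case_sum (\<lambda>_::int. 0) ((\<lambda>x. Q' (P (P' (Q (Q' (P e))))) x - Q' (P e) x) \<circ> Inr) = (\<lambda>_. 0)"
    by (simp only: proj)
  from fun_cong[OF this, of "Inr 0"] have eq: "Q' (P (P' (Q (Q' (P e))))) (Inr 0) = Q' (P e) (Inr 0)"
    by simp
  have W: "Q' (P f) (Inr y) = \<kappa> * (\<Sum>j\<in>{1..m}. f (Inr ((int m * y + int j) div int n)))" for f y
    by (simp add: P_def Q'_def rep_avg_S[OF nm(1)] rep_avg_T_adj \<kappa>_def flip: sum_distrib_left)
  have V: "P' (Q f) (Inr x) = \<kappa> * (\<Sum>i\<in>{1..n}. f (Inr ((int n * x + int i - 2) div int m)))" for f x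
    by (simp add: P'_def Q_def rep_avg_T[OF nm(2)] rep_avg_S_adj \<kappa>_def flip: sum_distrib_left)
  \<comment> \<open>Walk counts: \<open>w y\<close> counts edges from the right vertex
    \<open>y\<close> to the left vertex -1, \<open>v x\<close> walks of length two from the left
    vertex \<open>x\<close> to it, and \<open>u\<close> walks of length three from the right vertex
    0 to it.\<close>
  define w where "w y = (\<Sum>j\<in>{1..m}. if (int m * y + int j) div int n = - 1 then 1 else 0 :: nat)" for y
  define v where "v x = (\<Sum>i\<in>{1..n}. w ((int n * x + int i - 2) div int m))" for x
  define u where "u = (\<Sum>j\<in>{1..m}. v (int j div int n))"
  have 1: "Q' (P e) (Inr y) = \<kappa> * of_nat (w y)" for y
    by (simp add: W w_def e_def)
  have 2: "P' (Q (Q' (P e))) (Inr x) = \<kappa> * (\<kappa> * of_nat (v x))" for x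
    by (simp add: V v_def 1 flip: sum_distrib_left)
  have 3: "Q' (P (P' (Q (Q' (P e))))) (Inr 0) = \<kappa> * (\<kappa> * (\<kappa> * of_nat u))"
    by (simp add: W[of "P' (Q (Q' (P e)))"] u_def 2 flip: sum_distrib_left)
  \<comment> \<open>The edges at the right vertex 0 are 1 to \<open>m\<close>, and
    \<open>j div n\<close> is nonnegative for each of them.\<close>
  have "w 0 = 0"
    by (simp add: w_def flip: of_nat_div)
  then have "u = 0" using eq \<kappa> by (simp add: 1 3)
  moreover have "w (- 1) \<ge> 1"
  proof -
    \<comment> \<open>The edge -1 joins the right vertex -1 to the left vertex -1; its index
      \<open>j = m - 1\<close> lies in range because \<open>m\<close> is at least 2.\<close>
    have "(int m * - 1 + int (m - 1)) div int n = - 1"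
      using assms by (simp add: of_nat_diff div_eq_minus1)
    then show ?thesis
      unfolding w_def using assms
      by (intro order.trans[OF _ member_le_sum[of "m - 1"]]) auto
  qed
  moreover have "w (- 1) \<le> v 0"
  proof -
    \<comment> \<open>The edge 0, of index 1, joins the left vertex 0 to the right vertex
      -1.\<close>
    have "(int n * 0 + int 1 - 2) div int m = - 1" using assms by (simp add: div_eq_minus1)
    then show ?thesis
      unfolding v_def using assms
      by (intro order.trans[OF _ member_le_sum[of 1]]) auto
  qed
  moreover have "v 0 \<le> u"
    \<comment> \<open>The edge 1 joins the right vertex 0 to the left vertex 0, as
      \<open>1 div n = 0\<close> for \<open>n\<close> at least 2.\<close>
    unfolding u_def using assms
    by (intro order.trans[OF _ member_le_sum[of 1]]) auto
  ultimately show False by simp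
qed


section \<open>Quotients and completions\<close>

lemma quot_carrier_iff: "U \<in> carrier (quot_algebra A I) \<longleftrightarrow> (\<exists>x\<in>carrier A. U = I +>\<^bsub>A\<^esub> x)"
  by (auto simp: FactRing_simps)

context
  fixes A :: "('a, 'b) normed_star_algebra_scheme" and I
  assumes I: "ideal I A"
begin

lemma quot_mult:
  assumes "x \<in> carrier A" "y \<in> carrier A"
  shows "(I +>\<^bsub>A\<^esub> x) \<otimes>\<^bsub>quot_algebra A I\<^esub> (I +>\<^bsub>A\<^esub> y) = I +>\<^bsub>A\<^esub> (x \<otimes>\<^bsub>A\<^esub> y)"
  using assms ideal.rcoset_mult_add[OF I] by (simp add: FactRing_def)

lemma quot_add:
  assumes "x \<in> carrier A" "y \<in> carrier A"
  shows "(I +>\<^bsub>A\<^esub> x) \<oplus>\<^bsub>quot_algebra A I\<^esub> (I +>\<^bsub>A\<^esub> y) = I +>\<^bsub>A\<^esub> (x \<oplus>\<^bsub>A\<^esub> y)"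
  using assms ideal.a_rcos_sum[OF I] by (simp add: FactRing_def)

lemma quot_zero: "\<zero>\<^bsub>quot_algebra A I\<^esub> = I +>\<^bsub>A\<^esub> \<zero>\<^bsub>A\<^esub>"
proof -
  interpret ideal I A by (rule I)
  show ?thesis using a_rcos_const[of "\<zero>\<^bsub>A\<^esub>"] by (simp add: FactRing_def)
qed

lemma quot_eq_iff:
  assumes "x \<in> carrier A" "y \<in> carrier A"
  shows "I +>\<^bsub>A\<^esub> x = I +>\<^bsub>A\<^esub> y \<longleftrightarrow> x \<ominus>\<^bsub>A\<^esub> y \<in> I"
  using ring.quotient_eq_iff_same_a_r_cos[OF ideal.axioms(2)[OF I] I assms] by simp

lemma quot_minus:
  assumes x: "x \<in> carrier A" and y: "y \<in> carrier A"
  shows "(I +>\<^bsub>A\<^esub> x) \<ominus>\<^bsub>quot_algebra A I\<^esub> (I +>\<^bsub>A\<^esub> y) = I +>\<^bsub>A\<^esub> (x \<ominus>\<^bsub>A\<^esub> y)"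
proof -
  interpret A: ring A by (rule ideal.axioms(2)[OF I])
  interpret Q: ring "quot_algebra A I" by (rule quot_algebra_ring[OF I])
  have "\<ominus>\<^bsub>quot_algebra A I\<^esub> (I +>\<^bsub>A\<^esub> y) = I +>\<^bsub>A\<^esub> (\<ominus>\<^bsub>A\<^esub> y)"
  proof (rule Q.minus_equality)
    show "(I +>\<^bsub>A\<^esub> (\<ominus>\<^bsub>A\<^esub> y)) \<oplus>\<^bsub>quot_algebra A I\<^esub> (I +>\<^bsub>A\<^esub> y) = \<zero>\<^bsub>quot_algebra A I\<^esub>"
      using y by (simp add: quot_add quot_zero A.l_neg del: quot_algebra_simps)
  qed (use y quot_carrier_iff in blast)+
  then show ?thesis
    using x y by (simp add: a_minus_def quot_add del: quot_algebra_simps)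
qed

text \<open>All representatives lead to the same coset, so the union in \<open>quot_algebra\<close>
  collapses.\<close>

lemma quot_smult:
  assumes x: "x \<in> carrier A"
    and cl: "\<And>y. y \<in> carrier A \<Longrightarrow> c \<odot>\<^bsub>A\<^esub> y \<in> carrier A"
    and add: "\<And>y z. y \<in> carrier A \<Longrightarrow> z \<in> carrier A \<Longrightarrow>
      c \<odot>\<^bsub>A\<^esub> (y \<oplus>\<^bsub>A\<^esub> z) = c \<odot>\<^bsub>A\<^esub> y \<oplus>\<^bsub>A\<^esub> c \<odot>\<^bsub>A\<^esub> z"
    and sub: "\<And>y. y \<in> I \<Longrightarrow> c \<odot>\<^bsub>A\<^esub> y \<in> I"
  shows "c \<odot>\<^bsub>quot_algebra A I\<^esub> (I +>\<^bsub>A\<^esub> x) = I +>\<^bsub>A\<^esub> (c \<odot>\<^bsub>A\<^esub> x)"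
proof -
  interpret ideal I A by (rule I)
  have "I +>\<^bsub>A\<^esub> (c \<odot>\<^bsub>A\<^esub> v) = I +>\<^bsub>A\<^esub> (c \<odot>\<^bsub>A\<^esub> x)" if v: "v \<in> I +>\<^bsub>A\<^esub> x" for v
  proof -
    obtain i where i: "i \<in> I" "v = i \<oplus>\<^bsub>A\<^esub> x" using v by (auto simp: a_r_coset_def')
    then have "c \<odot>\<^bsub>A\<^esub> v \<in> I +>\<^bsub>A\<^esub> (c \<odot>\<^bsub>A\<^esub> x)"
      using x sub by (auto simp: a_r_coset_def' add Icarr)
    from a_repr_independence[OF this cl[OF x] a_subgroup] show ?thesis by simp
  qed
  then have "(\<Union>v\<in>I +>\<^bsub>A\<^esub> x. I +>\<^bsub>A\<^esub> (c \<odot>\<^bsub>A\<^esub> v)) = (\<Union>v\<in>I +>\<^bsub>A\<^esub> x. I +>\<^bsub>A\<^esub> (c \<odot>\<^bsub>A\<^esub> x))"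
    by (intro SUP_cong refl)
  moreover have "I +>\<^bsub>A\<^esub> x \<noteq> {}" using a_rcos_self[OF x] by blast
  ultimately show ?thesis by (simp add: quot_algebra_def)
qed

end

text \<open>For each closed ideal \<open>I\<close> containing \<open>X\<close>, the elements with
  adjoint in \<open>I\<close> again form a closed ideal containing \<open>X\<close>: the adjoint is
  isometric, reverses products and preserves \<open>X\<close>.\<close>

lemma closed_ideal_gen_adj:
  fixes A :: "('a, 'b) normed_star_algebra_scheme"
  assumes "ring A" and X: "X \<subseteq> carrier A"
    and cl: "\<And>y. y \<in> carrier A \<Longrightarrow> adj A y \<in> carrier A"
    and add: "\<And>y z. y \<in> carrier A \<Longrightarrow> z \<in> carrier A \<Longrightarrow> adj A (y \<oplus>\<^bsub>A\<^esub> z) = adj A y \<oplus>\<^bsub>A\<^esub> adj A z"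
    and mult: "\<And>y z. y \<in> carrier A \<Longrightarrow> z \<in> carrier A \<Longrightarrow> adj A (y \<otimes>\<^bsub>A\<^esub> z) = adj A z \<otimes>\<^bsub>A\<^esub> adj A y"
    and norm: "\<And>y. y \<in> carrier A \<Longrightarrow> cnorm A (adj A y) = cnorm A y"
    and inv: "\<And>y. y \<in> carrier A \<Longrightarrow> adj A (adj A y) = y"
    and X_adj: "\<And>y. y \<in> X \<Longrightarrow> adj A y \<in> X"
    and y: "y \<in> closed_ideal_gen A X"
  shows "adj A y \<in> closed_ideal_gen A X"
  unfolding closed_ideal_gen_def
proof (intro InterI)
  interpret A: ring A by (rule assms)
  have minus: "adj A (\<ominus>\<^bsub>A\<^esub> y) = \<ominus>\<^bsub>A\<^esub> adj A y" if y: "y \<in> carrier A" for y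
  proof -
    have "adj A \<zero>\<^bsub>A\<^esub> \<oplus>\<^bsub>A\<^esub> adj A \<zero>\<^bsub>A\<^esub> = adj A \<zero>\<^bsub>A\<^esub>"
      using add[of "\<zero>\<^bsub>A\<^esub>" "\<zero>\<^bsub>A\<^esub>"] by simp
    then have "adj A \<zero>\<^bsub>A\<^esub> = \<zero>\<^bsub>A\<^esub>" using cl[of "\<zero>\<^bsub>A\<^esub>"] A.add.l_cancel_one by simp
    then have "adj A (\<ominus>\<^bsub>A\<^esub> y) \<oplus>\<^bsub>A\<^esub> adj A y = \<zero>\<^bsub>A\<^esub>"
      using add[of "\<ominus>\<^bsub>A\<^esub> y" y] y by (simp add: A.l_neg)
    then show ?thesis using A.minus_equality y cl by simp
  qed
  fix I assume "I \<in> {I. ideal I A \<and> closed_in_norm A I \<and> X \<subseteq> I}"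
  then have I: "ideal I A" "closed_in_norm A I" "X \<subseteq> I" by auto
  interpret I: ideal I A by (rule I(1))
  define I' where "I' = {y \<in> carrier A. adj A y \<in> I}"
  have "ideal I' A"
  proof (rule idealI[OF A.ring_axioms])
    show "subgroup I' (add_monoid A)"
    proof (rule A.add.subgroupI)
      have "\<zero>\<^bsub>A\<^esub> \<in> I'"
        using add[of "\<zero>\<^bsub>A\<^esub>" "\<zero>\<^bsub>A\<^esub>"] cl[of "\<zero>\<^bsub>A\<^esub>"] A.add.l_cancel_one by (simp add: I'_def)
      then show "I' \<noteq> {}" by blast
      show "\<ominus>\<^bsub>A\<^esub> a \<in> I'" if "a \<in> I'" for a
        using that by (simp add: I'_def minus)
    qed (auto simp: I'_def add)
    fix a x assume "a \<in> I'" "x \<in> carrier A"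
    then show "x \<otimes>\<^bsub>A\<^esub> a \<in> I'" "a \<otimes>\<^bsub>A\<^esub> x \<in> I'"
      by (auto simp: I'_def mult cl I.I_l_closed I.I_r_closed)
  qed
  moreover have "closed_in_norm A I'"
    unfolding closed_in_norm_def
  proof (intro ballI impI)
    fix x assume x: "x \<in> carrier A" "\<forall>e>0. \<exists>y\<in>I'. cnorm A (x \<ominus>\<^bsub>A\<^esub> y) < e"
    have "\<exists>y\<in>I. cnorm A (adj A x \<ominus>\<^bsub>A\<^esub> y) < e" if e: "e > 0" for e :: real
    proof -
      obtain y where y: "y \<in> I'" "cnorm A (x \<ominus>\<^bsub>A\<^esub> y) < e" using x(2) e by blast
      then have "cnorm A (adj A x \<ominus>\<^bsub>A\<^esub> adj A y) < e"
        using norm[of "x \<ominus>\<^bsub>A\<^esub> y"] x(1) by (simp add: I'_def a_minus_def add minus)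
      then show ?thesis using y(1) by (auto simp: I'_def)
    qed
    then have "adj A x \<in> I" using I(2) cl[OF x(1)] unfolding closed_in_norm_def by blast
    then show "x \<in> I'" using x(1) by (simp add: I'_def)
  qed
  moreover have "X \<subseteq> I'" using X I(3) X_adj by (auto simp: I'_def)
  ultimately have "y \<in> I'" using y unfolding closed_ideal_gen_def by blast
  then show "adj A y \<in> I" by (simp add: I'_def)
qed

section \<open>The completion with respect to a C*-seminorm\<close>

locale cstar_completion =
  fixes G :: "'g set" and u :: "'g free_alg \<Rightarrow> real"
  assumes seminorm: "cstar_seminorm (free_star_algebra G) u"
begin

abbreviation "F \<equiv> free_star_algebra G"
abbreviation "C \<equiv> cauchy_algebra F u"
abbreviation "N \<equiv> null_seqs F u"
abbreviation "L \<equiv> completion F u"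
abbreviation "cls x \<equiv> N +>\<^bsub>C\<^esub> x"

lemmas ideal_N = ideal_null_seqs[OF seminorm]
lemmas L_def = completion_def[of F u]
lemmas ring_C = ring_cauchy_algebra[OF seminorm]
lemmas C_carrier = cauchy_carrier[OF seminorm]
lemmas C_ops = cauchy_ops[OF seminorm]
lemmas const_C = cauchy_const[OF seminorm]

lemma ring_L: "ring L"
  unfolding L_def by (rule quot_algebra_ring[OF ideal_N])

lemma C_minus:
  assumes "x \<in> carrier C" "y \<in> carrier C" shows "x \<ominus>\<^bsub>C\<^esub> y = (\<lambda>k. x k - y k)"
proof -
  interpret C: ring C by (rule ring_C)
  have "\<ominus>\<^bsub>C\<^esub> y = (\<lambda>k. - y k)"
    by (rule C.minus_equality) (use assms cauchy_minus[OF seminorm] in \<open>auto simp: C_ops\<close>)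
  then show ?thesis by (simp add: a_minus_def C_ops)
qed

lemma diff_C: "x \<in> carrier C \<Longrightarrow> y \<in> carrier C \<Longrightarrow> (\<lambda>k. x k - y k) \<in> carrier C"
  using C_minus ring.ring_simprules(4)[OF ring_C, of x y] by simp

lemmas add_C = cauchy_add[OF seminorm]
lemmas mult_C = cauchy_mult[OF seminorm]

lemma L_carrier: "U \<in> carrier L \<longleftrightarrow> (\<exists>x\<in>carrier C. U = cls x)"
  unfolding L_def by (rule quot_carrier_iff)

lemma cls_carrier [simp]: "x \<in> carrier C \<Longrightarrow> cls x \<in> carrier L"
  using L_carrier by blast

lemma cls_eq_iff:
  assumes "x \<in> carrier C" "y \<in> carrier C"
  shows "cls x = cls y \<longleftrightarrow> (\<lambda>k. u (x k - y k)) \<longlonglongrightarrow> 0"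
  using quot_eq_iff[OF ideal_N assms] C_minus[OF assms] null_seqs_iff[OF seminorm] diff_C[OF assms]
  by (simp add: C_carrier)

context
  fixes x y assumes x: "x \<in> carrier C" and y: "y \<in> carrier C"
begin

lemma cls_mult: "cls x \<otimes>\<^bsub>L\<^esub> cls y = cls (\<lambda>k. x k * y k)"
  unfolding L_def using quot_mult[OF ideal_N x y] by (simp add: C_ops)

lemma cls_add: "cls x \<oplus>\<^bsub>L\<^esub> cls y = cls (\<lambda>k. x k + y k)"
  unfolding L_def using quot_add[OF ideal_N x y] by (simp add: C_ops)

lemma cls_minus: "cls x \<ominus>\<^bsub>L\<^esub> cls y = cls (\<lambda>k. x k - y k)"
  unfolding L_def using quot_minus[OF ideal_N x y] by (simp add: C_minus x y)

end

lemma adj_C: "x \<in> carrier C \<Longrightarrow> (\<lambda>k. free_adj (x k)) \<in> carrier C"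
  using cauchy_adj(1)[OF seminorm] by (simp add: cauchy_algebra_def)

lemmas cls_adj = completion_adj[OF seminorm]

lemma L_adj:
  assumes "U \<in> carrier L"
  shows "adj L U \<in> carrier L" "adj L (adj L U) = U"
  using assms by (auto simp: L_carrier cls_adj adj_C)

lemma L_adj_add_mult:
  assumes "U \<in> carrier L" "V \<in> carrier L"
  shows "adj L (U \<oplus>\<^bsub>L\<^esub> V) = adj L U \<oplus>\<^bsub>L\<^esub> adj L V" "adj L (U \<otimes>\<^bsub>L\<^esub> V) = adj L V \<otimes>\<^bsub>L\<^esub> adj L U"
    "adj L (U \<ominus>\<^bsub>L\<^esub> V) = adj L U \<ominus>\<^bsub>L\<^esub> adj L V"
  using assms
  by (auto simp: L_carrier cls_adj adj_C cls_add cls_mult cls_minus add_C mult_C diff_C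
      free_adj_add free_adj_mult free_adj_minus)

text \<open>The reverse triangle inequality makes the norms a Cauchy sequence, so the
  \<open>lim\<close> in \<open>cnorm\<close> is a genuine limit.\<close>

lemma u_convergent:
  assumes x: "x \<in> carrier C" shows "(\<lambda>k. u (x k)) \<longlonglongrightarrow> lim (\<lambda>k. u (x k))"
proof -
  have F: "x k \<in> carrier F" for k using x by (simp add: C_carrier)
  have diff: "\<bar>u (x j) - u (x k)\<bar> \<le> u (x j - x k)" for j k
    using cs_add[OF seminorm, of "x j - x k" "x k"] cs_add[OF seminorm, of "x k - x j" "x j"]
      cs_minus[OF seminorm, of "x j - x k"] F by simp
  have "Cauchy (\<lambda>k. u (x k))"
    unfolding Cauchy_def
  proof (intro allI impI)
    fix e :: real assume "e > 0"
    then obtain M where "\<forall>j\<ge>M. \<forall>k\<ge>M. u (x j - x k) < e" using x unfolding C_carrier by blast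
    then show "\<exists>M. \<forall>j\<ge>M. \<forall>k\<ge>M. dist (u (x j)) (u (x k)) < e"
      using diff unfolding dist_real_def by (meson le_less_trans)
  qed
  then show ?thesis by (simp add: Cauchy_convergent_iff convergent_LIMSEQ_iff)
qed

text \<open>Adding a null sequence does not change the limit of the norms, so the infimum defining
  the quotient norm is over a constant.\<close>

lemma cls_cnorm:
  assumes x: "x \<in> carrier C" shows "cnorm L (cls x) = lim (\<lambda>k. u (x k))"
proof -
  interpret ideal N C by (rule ideal_N)
  have "cnorm C v = cnorm C x" if v: "v \<in> cls x" for v
  proof -
    obtain h where h: "h \<in> N" "v = (\<lambda>k. h k + x k)"
      using v by (auto simp: a_r_coset_def' C_ops)
    have F: "x k \<in> carrier F" "h k \<in> carrier F" for k
      using x h(1) by (simp_all add: C_carrier null_seqs_iff[OF seminorm])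
    have bd: "\<bar>u (v k) - u (x k)\<bar> \<le> u (h k)" for k
      using cs_add[OF seminorm, of "h k" "x k"] cs_add[OF seminorm, of "v k" "- h k"]
        cs_minus[OF seminorm, of "h k"] F by (simp add: h(2))
    have "(\<lambda>k. u (v k) - u (x k)) \<longlonglongrightarrow> 0"
    proof (rule tendsto_0_le[where K = 1])
      show "(\<lambda>k. u (h k)) \<longlonglongrightarrow> 0" using h(1) by (simp add: null_seqs_iff[OF seminorm])
      show "\<forall>\<^sub>F k in sequentially. norm (u (v k) - u (x k)) \<le> norm (u (h k)) * 1"
        using bd by (intro always_eventually allI) (smt (verit) real_norm_def mult_1_right)
    qed
    from tendsto_add[OF this u_convergent[OF x]] have "lim (\<lambda>k. u (v k)) = lim (\<lambda>k. u (x k))"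
      by (intro limI) simp
    then show ?thesis by (simp add: cauchy_algebra_def)
  qed
  moreover have "cls x \<noteq> {}" using a_rcos_self[OF x] by blast
  ultimately have "cnorm L (cls x) = cnorm C x"
    unfolding L_def by (simp add: quot_algebra_def)
  then show ?thesis by (simp add: cauchy_algebra_def)
qed

lemma L_adj_cnorm:
  assumes "U \<in> carrier L" shows "cnorm L (adj L U) = cnorm L U"
proof -
  obtain x where x: "x \<in> carrier C" "U = cls x" using assms by (auto simp: L_carrier)
  have "u (free_adj (x k)) = u (x k)" for k using x(1) by (intro cs_adj[OF seminorm]) (simp add: C_carrier)
  then show ?thesis using x by (simp add: cls_adj cls_cnorm adj_C)
qed

lemma scale_C:
  assumes "x \<in> carrier C" shows "(\<lambda>k. Poly_Mapping.single 0 c * x k) \<in> carrier C"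
  by (rule mult_C[OF const_C assms]) (simp add: zero_word_def)

lemma cls_smult:
  assumes x: "x \<in> carrier C" shows "c \<odot>\<^bsub>L\<^esub> cls x = cls (\<lambda>k. Poly_Mapping.single 0 c * x k)"
proof -
  have sm: "c \<odot>\<^bsub>C\<^esub> y = (\<lambda>k. Poly_Mapping.single 0 c * y k)" for y
    by (simp add: cauchy_algebra_def)
  have "c \<odot>\<^bsub>quot_algebra C N\<^esub> (cls x) = cls (c \<odot>\<^bsub>C\<^esub> x)"
  proof (rule quot_smult[OF ideal_N x])
    fix y assume "y \<in> N"
    then show "c \<odot>\<^bsub>C\<^esub> y \<in> N"
      unfolding sm by (rule null_mult(1)[OF seminorm _ const_C]) (simp add: zero_word_def)
  qed (simp_all add: sm scale_C C_ops algebra_simps)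
  then show ?thesis by (simp add: L_def sm)
qed

section \<open>Kernels of dominated seminorms\<close>

text \<open>For a C*-seminorm \<open>p\<close> below \<open>u\<close>, this is the kernel of the
  induced homomorphism from \<open>L\<close> to the completion at \<open>p\<close>, described by
  sequences so that the homomorphism itself need not be built.\<close>

definition kernel :: "('g free_alg \<Rightarrow> real) \<Rightarrow> (nat \<Rightarrow> 'g free_alg) set set" where
  "kernel p = {cls x | x. x \<in> carrier C \<and> (\<lambda>k. p (x k)) \<longlonglongrightarrow> 0}"

context
  fixes p
  assumes p: "cstar_seminorm F p" and p_le: "\<And>a. a \<in> carrier F \<Longrightarrow> p a \<le> u a"
begin

text \<open>Independent of the representative, because \<open>p (x k)\<close> is at most
  \<open>u (x k - y k) + p (y k)\<close>.\<close>

lemma cls_in_kernel: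
  assumes x: "x \<in> carrier C" shows "cls x \<in> kernel p \<longleftrightarrow> (\<lambda>k. p (x k)) \<longlonglongrightarrow> 0"
proof
  assume "cls x \<in> kernel p"
  then obtain y where y: "y \<in> carrier C" "(\<lambda>k. p (y k)) \<longlonglongrightarrow> 0" "cls x = cls y"
    by (auto simp: kernel_def)
  have F: "x k \<in> carrier F" "y k \<in> carrier F" for k using x y by (simp_all add: C_carrier)
  have "(\<lambda>k. u (x k - y k)) \<longlonglongrightarrow> 0" using y(3) cls_eq_iff[OF x y(1)] by simp
  from tendsto_add[OF this y(2)] have lim: "(\<lambda>k. u (x k - y k) + p (y k)) \<longlonglongrightarrow> 0" by simp
  have "p (x k) \<le> u (x k - y k) + p (y k)" "0 \<le> p (x k)" for k
    using cs_add[OF p, of "x k - y k" "y k"] p_le[of "x k - y k"] cs_nonneg[OF p, of "x k" 0] F by auto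
  then show "(\<lambda>k. p (x k)) \<longlonglongrightarrow> 0"
    by (intro tendsto_sandwich[OF _ _ tendsto_const lim]) auto
qed (use x in \<open>auto simp: kernel_def\<close>)

lemma C_subset: "x \<in> carrier C \<Longrightarrow> x \<in> carrier (cauchy_algebra F p)"
  unfolding C_carrier cauchy_carrier[OF p] by (meson free_carrier_closed(4) le_less_trans p_le)

text \<open>Sequences that are Cauchy for \<open>u\<close> are Cauchy for \<open>p\<close>, so the
  ideal laws are inherited from the null sequences of \<open>p\<close>.\<close>

lemma ideal_kernel: "ideal (kernel p) L"
proof -
  interpret L: ring L by (rule ring_L)
  interpret P: ideal "null_seqs F p" "cauchy_algebra F p" by (rule ideal_null_seqs[OF p])
  have null: "cls x \<in> kernel p \<longleftrightarrow> x \<in> null_seqs F p" if "x \<in> carrier C" for x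
    using that cls_in_kernel[OF that] by (simp add: null_seqs_iff[OF p] C_carrier)
  have E: "\<exists>x\<in>carrier C. U = cls x \<and> x \<in> null_seqs F p" if "U \<in> kernel p" for U
    using that null by (auto simp: kernel_def)
  have zero: "cls (\<lambda>k. 0) = \<zero>\<^bsub>L\<^esub>" using quot_zero[OF ideal_N] by (simp add: L_def C_ops)
  have uminus: "\<ominus>\<^bsub>L\<^esub> cls x = cls (\<lambda>k. - x k)" if "x \<in> carrier C" for x
    using cls_minus[OF const_C[of 0] that] that zero by (simp add: a_minus_def)
  show ?thesis
  proof (rule idealI[OF ring_L])
    show "subgroup (kernel p) (add_monoid L)"
    proof (rule L.add.subgroupI)
      have "cls (\<lambda>k. 0) \<in> kernel p" by (subst null) (simp_all add: const_C null_seqs_iff[OF p] cs_zero[OF p])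
      then show "kernel p \<noteq> {}" by blast
      show "kernel p \<subseteq> carrier L" by (auto simp: kernel_def)
      fix U assume "U \<in> kernel p"
      then obtain x where x: "x \<in> carrier C" "U = cls x" "x \<in> null_seqs F p" using E by blast
      have "(\<lambda>k. - x k) \<in> null_seqs F p"
        using x(1,3) by (simp add: null_seqs_iff[OF p] C_carrier cs_minus[OF p])
      then show "\<ominus>\<^bsub>L\<^esub> U \<in> kernel p"
        using x null cauchy_minus[OF seminorm x(1)] uminus by simp
      fix V assume "V \<in> kernel p"
      then obtain y where y: "y \<in> carrier C" "V = cls y" "y \<in> null_seqs F p" using E by blast
      have "(\<lambda>k. x k + y k) \<in> null_seqs F p" using additive_subgroup.a_closed[OF P.additive_subgroup_axioms x(3) y(3)] by (simp add: cauchy_ops[OF p])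
      then show "U \<oplus>\<^bsub>L\<^esub> V \<in> kernel p" using x y by (simp add: cls_add null add_C)
    qed
    fix U V assume "U \<in> kernel p" "V \<in> carrier L"
    then obtain x y where x: "x \<in> carrier C" "U = cls x" "x \<in> null_seqs F p"
      and y: "y \<in> carrier C" "V = cls y" using E L_carrier by metis
    then show "V \<otimes>\<^bsub>L\<^esub> U \<in> kernel p" "U \<otimes>\<^bsub>L\<^esub> V \<in> kernel p"
      by (simp_all add: cls_mult null mult_C null_mult[OF p x(3) C_subset])
  qed
qed

text \<open>If an element of the kernel is within \<open>e / 2\<close> of \<open>U\<close>, the
  triangle inequality puts \<open>p (x k)\<close> eventually below \<open>e\<close>. Closedness is
  what lets the kernel contain a closed ideal once it contains the generators.\<close>

lemma closed_kernel: "closed_in_norm L (kernel p)"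
  unfolding closed_in_norm_def
proof (intro ballI impI)
  fix U assume U: "U \<in> carrier L" "\<forall>e>0. \<exists>V\<in>kernel p. cnorm L (U \<ominus>\<^bsub>L\<^esub> V) < e"
  obtain x where x: "x \<in> carrier C" "U = cls x" using U(1) L_carrier by blast
  have Fx: "x k \<in> carrier F" for k using x by (simp add: C_carrier)
  have "(\<lambda>k. p (x k)) \<longlonglongrightarrow> 0"
  proof (rule LIMSEQ_I)
    fix e :: real assume "e > 0"
    then obtain V where V: "V \<in> kernel p" "cnorm L (U \<ominus>\<^bsub>L\<^esub> V) < e / 2" using U(2) by (meson half_gt_zero)
    obtain y where y: "y \<in> carrier C" "(\<lambda>k. p (y k)) \<longlonglongrightarrow> 0" "V = cls y"
      using V(1) by (auto simp: kernel_def)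
    have Fy: "y k \<in> carrier F" for k using y by (simp add: C_carrier)
    have "lim (\<lambda>k. u (x k - y k)) < e / 2"
      using V(2) by (simp add: x(2) y(3) cls_minus[OF x(1) y(1)] cls_cnorm diff_C x(1) y(1))
    with u_convergent[OF diff_C[OF x(1) y(1)]]
    have 1: "\<forall>\<^sub>F k in sequentially. u (x k - y k) < e / 2" by (rule order_tendstoD(2))
    have 2: "\<forall>\<^sub>F k in sequentially. p (y k) < e / 2"
      using y(2) by (rule order_tendstoD(2)) (use \<open>e > 0\<close> in simp)
    have "\<forall>\<^sub>F k in sequentially. norm (p (x k) - 0) < e"
      using 1 2
    proof eventually_elim
      case (elim k)
      then show ?case
        using cs_add[OF p, of "x k - y k" "y k"] p_le[of "x k - y k"] cs_nonneg[OF p, of "x k" 0] Fx[of k] Fy[of k]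
        by simp
    qed
    then show "\<exists>M. \<forall>k\<ge>M. norm (p (x k) - 0) < e" by (simp add: eventually_sequentially)
  qed
  then show "U \<in> kernel p" using x cls_in_kernel by simp
qed

end

end


section \<open>The image of the free algebra in \<open>O\<^sub>n\<^sub>,\<^sub>m\<close>\<close>

context cstar_completion
begin

section \<open>Calculating with relations in the free algebra\<close>

text \<open>Equality of the images in the completion, stated for elements of the free algebra.
  Membership in the carrier is included so that chains of equivalences carry their own side
  conditions.\<close>

definition eqv :: "'g free_alg \<Rightarrow> 'g free_alg \<Rightarrow> bool" (infix \<open>\<approx>\<close> 50) where
  "a \<approx> b \<longleftrightarrow> a \<in> carrier F \<and> b \<in> carrier F \<and> u (a - b) = 0"

lemma eqvI: "a \<in> carrier F \<Longrightarrow> b \<in> carrier F \<Longrightarrow> u (a - b) = 0 \<Longrightarrow> a \<approx> b"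
  by (simp add: eqv_def)

lemma eqv_refl: "a \<in> carrier F \<Longrightarrow> a \<approx> a"
  by (simp add: eqv_def cs_zero[OF seminorm])

lemma eqv_sym: "a \<approx> b \<Longrightarrow> b \<approx> a"
  using cs_minus[OF seminorm, of "a - b"] by (simp add: eqv_def)

lemma eqv_add: "a \<approx> b \<Longrightarrow> c \<approx> d \<Longrightarrow> a + c \<approx> b + d"
  using cs_add[OF seminorm, of "a - b" "c - d"] cs_nonneg[OF seminorm, of "a + c - (b + d)" 0]
  by (auto simp: eqv_def algebra_simps)

lemma eqv_trans [trans]: "a \<approx> b \<Longrightarrow> b \<approx> c \<Longrightarrow> a \<approx> c"
  using cs_add[OF seminorm, of "a - b" "b - c"] cs_nonneg[OF seminorm, of "a - c" 0]
  by (auto simp: eqv_def)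

lemma eqv_mult_left: "c \<in> carrier F \<Longrightarrow> a \<approx> b \<Longrightarrow> c * a \<approx> c * b"
  using cs_mult[OF seminorm, of c "a - b"] cs_nonneg[OF seminorm, of "c * a - c * b" 0]
  by (auto simp: eqv_def algebra_simps)

lemma eqv_mult_right: "c \<in> carrier F \<Longrightarrow> a \<approx> b \<Longrightarrow> a * c \<approx> b * c"
  using cs_mult[OF seminorm, of "a - b" c] cs_nonneg[OF seminorm, of "a * c - b * c" 0]
  by (auto simp: eqv_def algebra_simps)

lemma eqv_mult: "a \<approx> b \<Longrightarrow> c \<approx> d \<Longrightarrow> a * c \<approx> b * d"
  by (meson eqv_def eqv_mult_left eqv_mult_right eqv_trans)

lemma eqv_adj: "a \<approx> b \<Longrightarrow> free_adj a \<approx> free_adj b"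
  using cs_adj[OF seminorm, of "a - b"] by (simp add: eqv_def flip: free_adj_minus)

lemma eqv_sum: "(\<And>i. i \<in> I \<Longrightarrow> f i \<approx> g i) \<Longrightarrow> (\<Sum>i\<in>I. f i) \<approx> (\<Sum>i\<in>I. g i)"
  by (induction I rule: infinite_finite_induct) (simp_all add: eqv_refl eqv_add)

end

lemma single_0_commute: "Poly_Mapping.single 0 c * a = a * Poly_Mapping.single 0 c"
  for a :: "'g free_alg"
  by (induction a rule: free_alg_induct) (simp_all add: mult_single algebra_simps)

lemma sum_free_carrier:
  "(\<And>i. i \<in> I \<Longrightarrow> f i \<in> carrier (free_star_algebra G)) \<Longrightarrow> (\<Sum>i\<in>I. f i) \<in> carrier (free_star_algebra G)"
  by (induction I rule: infinite_finite_induct) auto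

lemma avg_carrier:
  assumes "\<And>i. i \<in> {1..N} \<Longrightarrow> g i \<in> G" shows "avg g N \<in> carrier (free_star_algebra G)"
  unfolding avg_def
  by (intro free_carrier_closed(6) sum_free_carrier)
    (use assms in \<open>auto simp: free_gen_def zero_word_def\<close>)

text \<open>Orthogonality kills the off-diagonal terms of the double sum, and the \<open>d\<close>
  diagonal ones each give \<open>q\<close>. This yields \<open>S^* S = T^* T = q\<close> in
  \<open>L\<close>.\<close>

lemma (in cstar_completion) avg_adj_avg:
  assumes d: "d \<ge> 1" and q: "q \<in> carrier F"
    and orth: "\<And>i k. i \<in> {1..d} \<Longrightarrow> k \<in> {1..d} \<Longrightarrow> i \<noteq> k \<Longrightarrow> free_adj (free_gen (g i)) * free_gen (g k) \<approx> 0"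
    and source: "\<And>i. i \<in> {1..d} \<Longrightarrow> free_adj (free_gen (g i)) * free_gen (g i) \<approx> q"
  shows "free_adj (avg g d) * avg g d \<approx> q"
proof -
  define c :: "'g free_alg" where "c = Poly_Mapping.single 0 (inv_sqrt d)"
  define S where "S = (\<Sum>i\<in>{1..d}. free_gen (g i))"
  have c: "c \<in> carrier F" by (simp add: c_def zero_word_def)
  have S: "free_adj S * S \<approx> of_nat d * q"
  proof -
    have "free_adj S * S = (\<Sum>i\<in>{1..d}. \<Sum>k\<in>{1..d}. free_adj (free_gen (g i)) * free_gen (g k))"
      by (simp add: S_def free_adj_sum sum_product)
    also have "\<dots> \<approx> (\<Sum>i\<in>{1..d}. \<Sum>k\<in>{1..d}. if i = k then q else 0)"
      using orth source by (intro eqv_sum) simp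
    also have "\<dots> = of_nat d * q" by simp
    finally show ?thesis .
  qed
  have "avg g d = c * S" by (simp add: avg_def c_def S_def)
  moreover have "free_adj c = c" by (simp add: c_def)
  moreover have "x * c = c * x" for x by (simp add: c_def single_0_commute)
  ultimately have "free_adj (avg g d) * avg g d = c * c * (free_adj S * S)"
    by (metis free_adj_mult mult.assoc)
  also have "\<dots> \<approx> c * c * (of_nat d * q)"
    by (intro eqv_mult_left S free_carrier_closed c)
  also have "c * c * (of_nat d * q) = q"
  proof -
    \<comment> \<open>Numerals are scalars on the empty word, which reduces the claim to an identity
      of complex numbers.\<close>
    have "of_nat d = (Poly_Mapping.single 0 (of_nat d) :: 'g free_alg)" by simp
    then have "c * c * of_nat d = Poly_Mapping.single 0 (inv_sqrt d * (inv_sqrt d * (of_nat d * 1)))"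
      by (simp only: c_def mult_single add_0_left mult.assoc mult_1_right)
    then have "c * c * of_nat d = 1" by (simp only: inv_sqrt_mult[OF d] single_one)
    then show ?thesis by (simp flip: mult.assoc)
  qed
  finally show ?thesis .
qed

lemma (in cstar_completion) avg_mult_source:
  assumes q: "q \<in> carrier F" and "\<And>i. i \<in> {1..d} \<Longrightarrow> free_gen (g i) * q \<approx> free_gen (g i)"
  shows "avg g d * q \<approx> avg g d"
  unfolding avg_def mult.assoc sum_distrib_right
  by (intro eqv_mult_left eqv_sum assms) (simp_all add: zero_word_def)

section \<open>The universal norm and the ideal \<open>J\<close>\<close>

abbreviation L_norm :: "nat \<Rightarrow> nat \<Rightarrow> gen free_alg \<Rightarrow> real" where
  "L_norm n m \<equiv> univ_seminorm (free_star_algebra (L_gens n m)) (L_rels n m)"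

interpretation L: cstar_completion "L_gens n m" "L_norm n m" for n m
  by unfold_locales (intro cstar_seminorm_univ L_seminorms_bdd)

lemma alg_L_eq: "alg_L n m = completion (free_star_algebra (L_gens n m)) (L_norm n m)"
  by (simp add: alg_L_def univ_cstar_def)

lemma L_gen_eq: "L_gen n m g = L.cls n m (\<lambda>_. free_gen g)"
  by (simp add: L_gen_def univ_cstar_gen_def to_completion_def)

text \<open>The supremum is over the constant 0; the zero seminorm shows that its index set is
  nonempty.\<close>

lemma L_norm_rel:
  assumes "r \<in> L_rels n m" shows "L_norm n m r = 0"
proof -
  have "{p. cstar_seminorm (free_star_algebra (L_gens n m)) p \<and> (\<forall>r\<in>L_rels n m. p r = 0)} \<noteq> {}"
    using cstar_seminorm_zero by fastforce
  then have "L_norm n m r = (SUP p\<in>{p. cstar_seminorm (free_star_algebra (L_gens n m)) p \<and> (\<forall>r\<in>L_rels n m. p r = 0)}. 0)"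
    unfolding univ_seminorm_def using assms by (intro SUP_cong) auto
  then show ?thesis using \<open>_ \<noteq> {}\<close> by simp
qed

text \<open>One admissible seminorm bounds the universal one from below, so what is nonzero in the
  representation survives in \<open>L\<close>.\<close>

lemma opnorm_le_L_norm:
  assumes "n \<ge> 1" "m \<ge> 1" "a \<in> carrier (free_star_algebra (L_gens n m))"
  shows "gen_action.opnorm n m a \<le> L_norm n m a"
  unfolding univ_seminorm_def
  by (rule cSUP_upper[OF _ L_seminorms_bdd[OF assms(3)]])
    (use opnorm_L_rels[OF assms(1,2)] gen_action.cstar_seminorm_opnorm in blast)

lemma gen_carrier: "g \<in> G \<Longrightarrow> free_gen g \<in> carrier (free_star_algebra G)"
  by (simp add: free_gen_def)

lemma L_semigroup_adj:
  assumes "x \<in> L_semigroup n m" shows "adj (alg_L n m) x \<in> L_semigroup n m"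
  using assms unfolding L_semigroup_def
proof (induction rule: semigroup_gen.induct)
  case (incl x)
  then show ?case
  proof
    assume "x \<in> L_gen n m ` L_gens n m"
    then show ?thesis by (intro semigroup_gen.incl) blast
  next
    assume "x \<in> (\<lambda>g. adj (alg_L n m) (L_gen n m g)) ` L_gens n m"
    then obtain g where g: "g \<in> L_gens n m" "x = adj (alg_L n m) (L_gen n m g)" by blast
    have "L_gen n m g \<in> carrier (alg_L n m)"
      unfolding alg_L_eq L_gen_eq by (intro L.cls_carrier L.const_C gen_carrier g)
    then have "adj (alg_L n m) x = L_gen n m g" unfolding g(2) alg_L_eq by (rule L.L_adj)
    with g(1) show ?thesis by (intro semigroup_gen.incl) blast
  qed
next
  case (prod x y)
  have "x \<in> carrier (alg_L n m)" "y \<in> carrier (alg_L n m)"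
    using prod.hyps L_semigroup_carrier unfolding L_semigroup_def by blast+
  then have "adj (alg_L n m) (x \<otimes>\<^bsub>alg_L n m\<^esub> y) = adj (alg_L n m) y \<otimes>\<^bsub>alg_L n m\<^esub> adj (alg_L n m) x"
    unfolding alg_L_eq by (rule L.L_adj_add_mult)
  then show ?case using prod.IH by (simp add: semigroup_gen.prod)
qed

text \<open>Generators and their adjoints are single letters and products concatenate. The
  generators of \<open>J\<close> therefore come from words, which act by partial injections.\<close>

lemma L_semigroup_word:
  assumes "x \<in> L_semigroup n m"
  obtains w where "fst ` set (letters w) \<subseteq> L_gens n m" "x = L.cls n m (\<lambda>_. Poly_Mapping.single w 1)"
proof -
  have "\<exists>w. fst ` set (letters w) \<subseteq> L_gens n m \<and> x = L.cls n m (\<lambda>_. Poly_Mapping.single w 1)"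
    using assms unfolding L_semigroup_def
  proof (induction rule: semigroup_gen.induct)
    case (incl x)
    then obtain g where g: "g \<in> L_gens n m" "x = L_gen n m g \<or> x = adj (alg_L n m) (L_gen n m g)" by blast
    have "adj (alg_L n m) (L_gen n m g) = L.cls n m (\<lambda>_. free_adj (free_gen g))"
      unfolding alg_L_eq L_gen_eq by (intro L.cls_adj L.const_C gen_carrier g)
    then have "x = L.cls n m (\<lambda>_. Poly_Mapping.single (Word [(g, False)]) 1) \<or>
        x = L.cls n m (\<lambda>_. Poly_Mapping.single (Word [(g, True)]) 1)"
      using g(2) by (simp add: L_gen_eq free_gen_def word_adj_def)
    moreover have "fst ` set (letters (Word [(g, b)])) \<subseteq> L_gens n m" for b using g(1) by simp
    ultimately show ?case by blast
  next
    case (prod x y)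
    then obtain v w where v: "fst ` set (letters v) \<subseteq> L_gens n m" "x = L.cls n m (\<lambda>_. Poly_Mapping.single v 1)"
      and w: "fst ` set (letters w) \<subseteq> L_gens n m" "y = L.cls n m (\<lambda>_. Poly_Mapping.single w 1)" by blast
    have "x \<otimes>\<^bsub>alg_L n m\<^esub> y = L.cls n m (\<lambda>_. Poly_Mapping.single v 1 * Poly_Mapping.single w 1)"
      unfolding alg_L_eq v(2) w(2) by (rule L.cls_mult) (use v w in \<open>auto intro!: L.const_C\<close>)
    then show ?case using v w
      by (intro exI[of _ "v + w"]) (auto simp: mult_single plus_word_def)
  qed
  then show thesis using that by blast
qed

text \<open>The kernel is one of the closed ideals intersected in \<open>ideal_J\<close>. The
  representation thus descends to the quotient.\<close>

lemma ideal_J_subset_kernel: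
  assumes "n \<ge> 1" "m \<ge> 1"
  shows "ideal_J n m \<subseteq> L.kernel n m (gen_action.opnorm n m)"
proof -
  note p = gen_action.cstar_seminorm_opnorm[of "L_gens n m" n m] opnorm_le_L_norm[OF assms]
  have "x \<otimes>\<^bsub>alg_L n m\<^esub> adj (alg_L n m) x \<otimes>\<^bsub>alg_L n m\<^esub> x \<ominus>\<^bsub>alg_L n m\<^esub> x \<in> L.kernel n m (gen_action.opnorm n m)"
    if x: "x \<in> L_semigroup n m" for x
  proof -
    obtain w where w: "fst ` set (letters w) \<subseteq> L_gens n m" "x = L.cls n m (\<lambda>_. Poly_Mapping.single w 1)"
      using L_semigroup_word[OF x] by blast
    define s :: "gen free_alg" where "s = Poly_Mapping.single w 1"
    have s: "s \<in> carrier (free_star_algebra (L_gens n m))" using w by (simp add: s_def)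
    have "x \<otimes>\<^bsub>alg_L n m\<^esub> adj (alg_L n m) x \<otimes>\<^bsub>alg_L n m\<^esub> x \<ominus>\<^bsub>alg_L n m\<^esub> x = L.cls n m (\<lambda>_. s * free_adj s * s - s)"
      unfolding alg_L_eq w(2) s_def[symmetric]
      using s by (simp add: L.cls_adj L.cls_mult L.cls_minus L.const_C)
    then show ?thesis
      using L.cls_in_kernel[OF p, of "\<lambda>_. s * free_adj s * s - s"] s
        gen_action.opnorm_word_partial_isometry[of n m w]
      by (simp add: L.const_C s_def)
  qed
  then show ?thesis
    unfolding ideal_J_def closed_ideal_gen_def
    using L.ideal_kernel[OF p] L.closed_kernel[OF p] by (intro Inter_lower) (auto simp: alg_L_eq)
qed

text \<open>The adjoint of \<open>x x^* x - x\<close> is the same expression in \<open>x^*\<close>,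
  which is again in the semigroup.\<close>

lemma ideal_J_adj:
  assumes "y \<in> ideal_J n m" shows "adj (alg_L n m) y \<in> ideal_J n m"
  using assms unfolding ideal_J_def
proof (rule closed_ideal_gen_adj[rotated -1])
  define A where "A = alg_L n m"
  interpret A: ring A unfolding A_def by (rule ring_alg_L)
  have S: "x \<in> carrier A" "adj A x \<in> carrier A" if "x \<in> L_semigroup n m" for x
    using L_semigroup_carrier L_semigroup_adj that unfolding A_def by blast+
  have adj_mult: "adj A (y \<otimes>\<^bsub>A\<^esub> z) = adj A z \<otimes>\<^bsub>A\<^esub> adj A y"
    and adj_minus: "adj A (y \<ominus>\<^bsub>A\<^esub> z) = adj A y \<ominus>\<^bsub>A\<^esub> adj A z"
    and adj_adj: "adj A (adj A y) = y"
    if "y \<in> carrier A" "z \<in> carrier A" for y z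
    using that unfolding A_def alg_L_eq by (simp_all add: L.L_adj_add_mult L.L_adj)
  show "{x \<otimes>\<^bsub>alg_L n m\<^esub> adj (alg_L n m) x \<otimes>\<^bsub>alg_L n m\<^esub> x \<ominus>\<^bsub>alg_L n m\<^esub> x | x. x \<in> L_semigroup n m} \<subseteq> carrier (alg_L n m)"
    using S unfolding A_def[symmetric] by auto
  fix y assume "y \<in> {x \<otimes>\<^bsub>alg_L n m\<^esub> adj (alg_L n m) x \<otimes>\<^bsub>alg_L n m\<^esub> x \<ominus>\<^bsub>alg_L n m\<^esub> x | x. x \<in> L_semigroup n m}"
  then obtain x where x: "x \<in> L_semigroup n m" "y = x \<otimes>\<^bsub>A\<^esub> adj A x \<otimes>\<^bsub>A\<^esub> x \<ominus>\<^bsub>A\<^esub> x" by (auto simp: A_def)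
  have "adj A y = adj A x \<otimes>\<^bsub>A\<^esub> adj A (adj A x) \<otimes>\<^bsub>A\<^esub> adj A x \<ominus>\<^bsub>A\<^esub> adj A x"
    using S[OF x(1)] by (simp add: x(2) adj_mult adj_minus adj_adj[OF _ A.zero_closed] A.m_assoc)
  then show "adj (alg_L n m) y \<in> {x \<otimes>\<^bsub>alg_L n m\<^esub> adj (alg_L n m) x \<otimes>\<^bsub>alg_L n m\<^esub> x \<ominus>\<^bsub>alg_L n m\<^esub> x | x. x \<in> L_semigroup n m}"
    using L_semigroup_adj[OF x(1)] unfolding A_def by blast
qed (unfold alg_L_eq, auto simp: L.ring_L L.L_adj L.L_adj_add_mult L.L_adj_cnorm)

section \<open>The canonical map from the free algebra to the quotient\<close>

definition to_O :: "nat \<Rightarrow> nat \<Rightarrow> gen free_alg \<Rightarrow> (nat \<Rightarrow> gen free_alg) set set" where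
  "to_O n m a = ideal_J n m +>\<^bsub>alg_L n m\<^esub> L.cls n m (\<lambda>_. a)"

context
  fixes n m :: nat
begin

private abbreviation "F \<equiv> free_star_algebra (L_gens n m)"

lemma const_alg_L: "a \<in> carrier F \<Longrightarrow> L.cls n m (\<lambda>_. a) \<in> carrier (alg_L n m)"
  unfolding alg_L_eq by (intro L.cls_carrier L.const_C)

lemma to_O_carrier: "a \<in> carrier F \<Longrightarrow> to_O n m a \<in> carrier (alg_O n m)"
  unfolding to_O_def alg_O_def quot_carrier_iff using const_alg_L by blast

lemma to_O_mult:
  assumes "a \<in> carrier F" "b \<in> carrier F"
  shows "to_O n m a \<otimes>\<^bsub>alg_O n m\<^esub> to_O n m b = to_O n m (a * b)"
  unfolding to_O_def alg_O_def quot_mult[OF ideal_ideal_J const_alg_L[OF assms(1)] const_alg_L[OF assms(2)]]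
  unfolding alg_L_eq L.cls_mult[OF L.const_C[OF assms(1)] L.const_C[OF assms(2)]] ..

lemma to_O_add:
  assumes "a \<in> carrier F" "b \<in> carrier F"
  shows "to_O n m a \<oplus>\<^bsub>alg_O n m\<^esub> to_O n m b = to_O n m (a + b)"
  unfolding to_O_def alg_O_def quot_add[OF ideal_ideal_J const_alg_L[OF assms(1)] const_alg_L[OF assms(2)]]
  unfolding alg_L_eq L.cls_add[OF L.const_C[OF assms(1)] L.const_C[OF assms(2)]] ..

lemma to_O_eq_iff:
  assumes "a \<in> carrier F" "b \<in> carrier F"
  shows "to_O n m a = to_O n m b \<longleftrightarrow> L.cls n m (\<lambda>_. a - b) \<in> ideal_J n m"
  unfolding to_O_def quot_eq_iff[OF ideal_ideal_J const_alg_L[OF assms(1)] const_alg_L[OF assms(2)]]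
  unfolding alg_L_eq L.cls_minus[OF L.const_C[OF assms(1)] L.const_C[OF assms(2)]] ..

lemma to_O_cong:
  assumes "L.eqv n m a b" shows "to_O n m a = to_O n m b"
proof -
  have F: "a \<in> carrier F" "b \<in> carrier F" and 0: "L_norm n m (a - b) = 0"
    using assms by (simp_all add: L.eqv_def)
  have "L.cls n m (\<lambda>_. a) = L.cls n m (\<lambda>_. b)"
    unfolding L.cls_eq_iff[OF L.const_C[OF F(1)] L.const_C[OF F(2)]] 0 by simp
  then show ?thesis by (simp add: to_O_def)
qed

lemma to_O_adj:
  assumes a: "a \<in> carrier F" shows "adj (alg_O n m) (to_O n m a) = to_O n m (free_adj a)"
proof -
  have "adj (alg_O n m) (to_O n m a) =
      ideal_J n m +>\<^bsub>alg_L n m\<^esub> adj (alg_L n m) (L.cls n m (\<lambda>_. a))"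
    unfolding to_O_def alg_O_def
    by (rule quot_adj[OF ideal_ideal_J const_alg_L[OF a]])
      (auto simp: ideal_J_adj, auto simp: alg_L_eq L.L_adj L.L_adj_add_mult)
  also have "adj (alg_L n m) (L.cls n m (\<lambda>_. a)) = L.cls n m (\<lambda>_. free_adj a)"
    unfolding alg_L_eq by (rule L.cls_adj[OF L.const_C[OF a]])
  finally show ?thesis by (simp add: to_O_def)
qed

lemma to_O_smult:
  assumes a: "a \<in> carrier F"
  shows "c \<odot>\<^bsub>alg_O n m\<^esub> to_O n m a = to_O n m (Poly_Mapping.single 0 c * a)"
proof -
  have sc: "Poly_Mapping.single 0 c \<in> carrier F" by (simp add: zero_word_def)
  \<comment> \<open>Scalar multiplication is multiplication by the class of a constant, so the ring
    ideal \<open>J\<close> is stable under it.\<close>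
  have scale: "c \<odot>\<^bsub>alg_L n m\<^esub> U = L.cls n m (\<lambda>_. Poly_Mapping.single 0 c) \<otimes>\<^bsub>alg_L n m\<^esub> U"
    if U: "U \<in> carrier (alg_L n m)" for U
  proof -
    obtain x where x: "x \<in> carrier (L.C n m)" "U = L.cls n m x"
      using U unfolding alg_L_eq L.L_carrier by blast
    show ?thesis
      unfolding alg_L_eq x(2) by (simp add: L.cls_smult x(1) L.cls_mult L.const_C[OF sc])
  qed
  interpret A: ring "alg_L n m" by (rule ring_alg_L)
  interpret J: ideal "ideal_J n m" "alg_L n m" by (rule ideal_ideal_J)
  have "c \<odot>\<^bsub>alg_O n m\<^esub> to_O n m a = ideal_J n m +>\<^bsub>alg_L n m\<^esub> (c \<odot>\<^bsub>alg_L n m\<^esub> L.cls n m (\<lambda>_. a))"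
    unfolding to_O_def alg_O_def
    by (rule quot_smult[OF ideal_ideal_J const_alg_L[OF a]])
      (simp_all add: scale const_alg_L[OF sc] A.r_distr J.I_l_closed J.Icarr)
  also have "c \<odot>\<^bsub>alg_L n m\<^esub> L.cls n m (\<lambda>_. a) = L.cls n m (\<lambda>_. Poly_Mapping.single 0 c * a)"
    unfolding alg_L_eq by (rule L.cls_smult[OF L.const_C[OF a]])
  finally show ?thesis by (simp add: to_O_def)
qed

lemma to_O_sum:
  assumes "finite K" "\<And>i. i \<in> K \<Longrightarrow> f i \<in> carrier F"
  shows "(\<Oplus>\<^bsub>alg_O n m\<^esub>i\<in>K. to_O n m (f i)) = to_O n m (\<Sum>i\<in>K. f i)"
  using assms
proof (induction K rule: finite_induct)
  interpret O: ring "alg_O n m" by (rule ring_alg_O)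
  case empty
  have "to_O n m 0 \<oplus>\<^bsub>alg_O n m\<^esub> to_O n m 0 = to_O n m 0" by (simp add: to_O_add)
  then have "to_O n m 0 = \<zero>\<^bsub>alg_O n m\<^esub>"
    using O.add.l_cancel_one to_O_carrier[of 0] by simp
  then show ?case by simp
next
  interpret O: ring "alg_O n m" by (rule ring_alg_O)
  case (insert i K)
  have "(\<Oplus>\<^bsub>alg_O n m\<^esub>k\<in>insert i K. to_O n m (f k)) =
      to_O n m (f i) \<oplus>\<^bsub>alg_O n m\<^esub> (\<Oplus>\<^bsub>alg_O n m\<^esub>k\<in>K. to_O n m (f k))"
    by (rule O.finsum_insert) (use insert in \<open>auto intro: to_O_carrier\<close>)
  then show ?case using insert by (simp add: to_O_add sum_free_carrier)
qed

lemma to_O_avg: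
  assumes "\<And>i. i \<in> {1..N} \<Longrightarrow> g i \<in> L_gens n m"
  shows "complex_of_real (1 / sqrt (real N)) \<odot>\<^bsub>alg_O n m\<^esub>
      (\<Oplus>\<^bsub>alg_O n m\<^esub>i\<in>{1..N}. to_O n m (free_gen (g i))) = to_O n m (avg g N)"
proof -
  have "(\<Oplus>\<^bsub>alg_O n m\<^esub>i\<in>{1..N}. to_O n m (free_gen (g i))) = to_O n m (\<Sum>i\<in>{1..N}. free_gen (g i))"
    using assms by (intro to_O_sum) (auto intro: gen_carrier)
  moreover have "(\<Sum>i\<in>{1..N}. free_gen (g i)) \<in> carrier F"
    using assms by (intro sum_free_carrier gen_carrier)
  ultimately show ?thesis by (simp only: to_O_smult avg_def inv_sqrt_def)
qed

lemma L_gens_mem: "i \<in> {1..n} \<Longrightarrow> GenS i \<in> L_gens n m" "j \<in> {1..m} \<Longrightarrow> GenT j \<in> L_gens n m"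
  by (simp_all add: L_gens_def)

lemma avg_mem: "avg GenS n \<in> carrier F" "avg GenT m \<in> carrier F"
  using L_gens_mem by (auto intro!: avg_carrier)

lemma O_R_eq: "O_R n m = to_O n m (avg GenS n * free_adj (avg GenT m))"
proof -
  have "O_s n m i = to_O n m (free_gen (GenS i))" "O_t n m i = to_O n m (free_gen (GenT i))" for i
    by (simp_all add: O_s_def O_t_def to_O_def L_gen_eq)
  then have "O_S n m = to_O n m (avg GenS n)" "O_T n m = to_O n m (avg GenT m)"
    using to_O_avg[of n GenS] to_O_avg[of m GenT] L_gens_mem by (simp_all only: O_S_def O_T_def)
  then show ?thesis by (simp add: O_R_def to_O_adj to_O_mult avg_mem)
qed

lemma partial_isometry_to_O_iff:
  assumes "a \<in> carrier F"
  shows "partial_isometry (alg_O n m) (to_O n m a) \<longleftrightarrow> to_O n m (a * free_adj a * a) = to_O n m a"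
  using assms by (simp add: partial_isometry_def to_O_carrier to_O_adj to_O_mult)

section \<open>\<open>R\<close> is a partial isometry and \<open>R^2\<close> is not\<close>

lemma eqv_rels:
  assumes "n \<ge> 1" "m \<ge> 1"
  defines "q \<equiv> free_adj (free_gen (GenS 1)) * free_gen (GenS 1)"
  shows "i \<in> {1..n} \<Longrightarrow> k \<in> {1..n} \<Longrightarrow> i \<noteq> k \<Longrightarrow> L.eqv n m (free_adj (free_gen (GenS i)) * free_gen (GenS k)) 0"
    and "j \<in> {1..m} \<Longrightarrow> l \<in> {1..m} \<Longrightarrow> j \<noteq> l \<Longrightarrow> L.eqv n m (free_adj (free_gen (GenT j)) * free_gen (GenT l)) 0"
    and "i \<in> {1..n} \<Longrightarrow> L.eqv n m (free_adj (free_gen (GenS i)) * free_gen (GenS i)) q"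
    and "j \<in> {1..m} \<Longrightarrow> L.eqv n m (free_adj (free_gen (GenT j)) * free_gen (GenT j)) q"
    and "i \<in> {1..n} \<Longrightarrow> L.eqv n m (free_gen (GenS i) * q) (free_gen (GenS i))"
    and "j \<in> {1..m} \<Longrightarrow> L.eqv n m (free_gen (GenT j) * q) (free_gen (GenT j))"
proof -
  have one: "1 \<in> {1..n}" "1 \<in> {1..m}" using assms by simp_all
  have C: "free_gen (GenS i) \<in> carrier F" "free_adj (free_gen (GenS i)) \<in> carrier F" if "i \<in> {1..n}" for i
    using L_gens_mem(1)[OF that] by (simp_all add: gen_carrier)
  have D: "free_gen (GenT i) \<in> carrier F" "free_adj (free_gen (GenT i)) \<in> carrier F" if "i \<in> {1..m}" for i
    using L_gens_mem(2)[OF that] by (simp_all add: gen_carrier)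
  have ST: "L.eqv n m (free_adj (free_gen (GenS i)) * free_gen (GenS i)) (free_adj (free_gen (GenT j)) * free_gen (GenT j))"
    if "i \<in> {1..n}" "j \<in> {1..m}" for i j
  proof (intro L.eqvI L_norm_rel)
    show "free_adj (free_gen (GenS i)) * free_gen (GenS i) - free_adj (free_gen (GenT j)) * free_gen (GenT j) \<in> L_rels n m"
      using that unfolding L_rels_def Let_def by blast
  qed (use C D that in auto)
  show "L.eqv n m (free_adj (free_gen (GenS i)) * free_gen (GenS k)) 0"
    if "i \<in> {1..n}" "k \<in> {1..n}" "i \<noteq> k" for i k
  proof (intro L.eqvI L_norm_rel)
    have "free_adj (free_gen (GenS i)) * free_gen (GenS k) \<in> L_rels n m"
      using that unfolding L_rels_def Let_def by blast
    then show "free_adj (free_gen (GenS i)) * free_gen (GenS k) - 0 \<in> L_rels n m" by simp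
  qed (use C that in auto)
  show "L.eqv n m (free_adj (free_gen (GenT j)) * free_gen (GenT l)) 0"
    if "j \<in> {1..m}" "l \<in> {1..m}" "j \<noteq> l" for j l
  proof (intro L.eqvI L_norm_rel)
    have "free_adj (free_gen (GenT j)) * free_gen (GenT l) \<in> L_rels n m"
      using that unfolding L_rels_def Let_def by blast
    then show "free_adj (free_gen (GenT j)) * free_gen (GenT l) - 0 \<in> L_rels n m" by simp
  qed (use D that in auto)
  show T: "L.eqv n m (free_adj (free_gen (GenT j)) * free_gen (GenT j)) q" if "j \<in> {1..m}" for j
    unfolding q_def by (rule L.eqv_sym[OF ST[OF one(1) that]])
  \<comment> \<open>The relations compare sources of \<open>s_i\<close> only with those of
    \<open>t_j\<close>, so the comparison with \<open>s_1\<close> passes through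
    \<open>t_1\<close>.\<close>
  show S: "L.eqv n m (free_adj (free_gen (GenS i)) * free_gen (GenS i)) q" if "i \<in> {1..n}" for i
    by (rule L.eqv_trans[OF ST[OF that one(2)] T[OF one(2)]])
  show "L.eqv n m (free_gen (GenS i) * q) (free_gen (GenS i))" if i: "i \<in> {1..n}" for i
  proof -
    have "L.eqv n m (free_gen (GenS i) * (free_adj (free_gen (GenS i)) * free_gen (GenS i))) (free_gen (GenS i))"
    proof (intro L.eqvI L_norm_rel)
      have "free_gen (GenS i) * free_adj (free_gen (GenS i)) * free_gen (GenS i) - free_gen (GenS i) \<in> L_rels n m"
        using i unfolding L_rels_def Let_def by blast
      then show "free_gen (GenS i) * (free_adj (free_gen (GenS i)) * free_gen (GenS i)) - free_gen (GenS i) \<in> L_rels n m"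
        by (simp add: mult.assoc)
    qed (use C i in auto)
    with L.eqv_mult_left[OF C(1)[OF i] L.eqv_sym[OF S[OF i]]] show ?thesis by (rule L.eqv_trans)
  qed
  show "L.eqv n m (free_gen (GenT j) * q) (free_gen (GenT j))" if j: "j \<in> {1..m}" for j
  proof -
    have "L.eqv n m (free_gen (GenT j) * (free_adj (free_gen (GenT j)) * free_gen (GenT j))) (free_gen (GenT j))"
    proof (intro L.eqvI L_norm_rel)
      have "free_gen (GenT j) * free_adj (free_gen (GenT j)) * free_gen (GenT j) - free_gen (GenT j) \<in> L_rels n m"
        using j unfolding L_rels_def Let_def by blast
      then show "free_gen (GenT j) * (free_adj (free_gen (GenT j)) * free_gen (GenT j)) - free_gen (GenT j) \<in> L_rels n m"
        by (simp add: mult.assoc)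
    qed (use D j in auto)
    with L.eqv_mult_left[OF D(1)[OF j] L.eqv_sym[OF T[OF j]]] show ?thesis by (rule L.eqv_trans)
  qed
qed

text \<open>Regrouping \<open>R R^* R\<close> as \<open>S (T^* T)\<close> times
  \<open>(S^* S) T^*\<close> exposes two copies of \<open>q\<close>, which are absorbed by
  \<open>S\<close> and by \<open>T^*\<close>. The identity holds already in
  \<open>L\<close>.\<close>

lemma partial_isometry_O_R:
  assumes nm: "n \<ge> 1" "m \<ge> 1"
  shows "partial_isometry (alg_O n m) (O_R n m)"
proof -
  define q where "q = free_adj (free_gen (GenS 1)) * free_gen (GenS 1)"
  define S where "S = avg GenS n"
  define T where "T = avg GenT m"
  note rels = eqv_rels[OF nm, folded q_def]
  have "GenS 1 \<in> L_gens n m" using nm by (simp add: L_gens_def)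
  then have q: "q \<in> carrier F" unfolding q_def by (intro free_carrier_closed free_adj_carrier gen_carrier)
  have mem: "S \<in> carrier F" "T \<in> carrier F" "free_adj S \<in> carrier F" "free_adj T \<in> carrier F"
    using avg_mem by (simp_all add: S_def T_def)
  have SS: "L.eqv n m (free_adj S * S) q" unfolding S_def by (rule L.avg_adj_avg[OF nm(1) q rels(1,3)])
  have TT: "L.eqv n m (free_adj T * T) q" unfolding T_def by (rule L.avg_adj_avg[OF nm(2) q rels(2,4)])
  have Sq: "L.eqv n m (S * q) S" unfolding S_def by (rule L.avg_mult_source[OF q rels(5)])
  have "L.eqv n m (T * q) T" unfolding T_def by (rule L.avg_mult_source[OF q rels(6)])
  from L.eqv_adj[OF this] have qT: "L.eqv n m (q * free_adj T) (free_adj T)"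
    by (simp add: free_adj_mult q_def)
  have "L.eqv n m (S * (free_adj T * T)) S"
    using L.eqv_mult_left[OF mem(1) TT] Sq by (rule L.eqv_trans)
  moreover have "L.eqv n m ((free_adj S * S) * free_adj T) (free_adj T)"
    using L.eqv_mult_right[OF mem(4) SS] qT by (rule L.eqv_trans)
  ultimately have "L.eqv n m ((S * (free_adj T * T)) * ((free_adj S * S) * free_adj T)) (S * free_adj T)"
    by (rule L.eqv_mult)
  then have "to_O n m ((S * (free_adj T * T)) * ((free_adj S * S) * free_adj T)) = to_O n m (S * free_adj T)"
    by (rule to_O_cong)
  moreover have "S * free_adj T * free_adj (S * free_adj T) * (S * free_adj T) =
      (S * (free_adj T * T)) * ((free_adj S * S) * free_adj T)"
    by (simp add: free_adj_mult mult.assoc)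
  ultimately show ?thesis
    using partial_isometry_to_O_iff[of "S * free_adj T"] mem
    by (simp add: O_R_eq flip: S_def T_def)
qed

text \<open>Otherwise the defect of \<open>r * r\<close> would lie in \<open>J\<close>, hence in the
  kernel, and its \<open>opnorm\<close> would vanish.\<close>

lemma not_partial_isometry_O_R_square:
  assumes "n \<ge> 2" "m \<ge> 2"
  shows "\<not> partial_isometry (alg_O n m) (O_R n m [^]\<^bsub>alg_O n m\<^esub> (2::nat))"
proof
  interpret O: ring "alg_O n m" by (rule ring_alg_O)
  have nm: "n \<ge> 1" "m \<ge> 1" using assms by simp_all
  define r where "r = avg GenS n * free_adj (avg GenT m)"
  have r: "r \<in> carrier F" "r * r \<in> carrier F" using avg_mem by (simp_all add: r_def)
  have "O_R n m [^]\<^bsub>alg_O n m\<^esub> (2::nat) = to_O n m (r * r)"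
    using r to_O_carrier[of r] by (simp add: O_R_eq numeral_2_eq_2 to_O_mult flip: r_def)
  moreover assume "partial_isometry (alg_O n m) (O_R n m [^]\<^bsub>alg_O n m\<^esub> (2::nat))"
  ultimately have "to_O n m (r * r * free_adj (r * r) * (r * r)) = to_O n m (r * r)"
    using partial_isometry_to_O_iff[OF r(2)] by simp
  moreover have F: "r * r * free_adj (r * r) * (r * r) \<in> carrier F" using r by simp
  ultimately have "L.cls n m (\<lambda>_. r * r * free_adj (r * r) * (r * r) - r * r) \<in> L.kernel n m (gen_action.opnorm n m)"
    using to_O_eq_iff[OF F r(2)] ideal_J_subset_kernel[OF nm] by blast
  then have "gen_action.opnorm n m (r * r * free_adj (r * r) * (r * r) - r * r) = 0"
    using F r(2)
    \<comment> \<open>The representative is a constant sequence, so its limit is 0 only if the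
      \<open>opnorm\<close> itself is 0.\<close>
    by (subst (asm) L.cls_in_kernel[OF gen_action.cstar_seminorm_opnorm opnorm_le_L_norm[OF nm]])
      (simp_all add: L.const_C LIMSEQ_const_iff)
  with opnorm_square_defect[OF assms r_def] show False by simp
qed

end

theorem proposition3p11:
  fixes n m :: nat
  assumes "n \<ge> 2" and "m \<ge> 2"
  shows "partial_isometry (alg_O n m) (O_R n m) \<and>
         \<not> power_partial_isometry (alg_O n m) (O_R n m) \<and>
         \<not> partial_isometry (alg_O n m) (O_R n m [^]\<^bsub>alg_O n m\<^esub> (2::nat))"
proof (intro conjI)
  show "partial_isometry (alg_O n m) (O_R n m)"
    using assms by (intro partial_isometry_O_R) simp_all
  show square: "\<not> partial_isometry (alg_O n m) (O_R n m [^]\<^bsub>alg_O n m\<^esub> (2::nat))"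
    by (rule not_partial_isometry_O_R_square[OF assms])
  then show "\<not> power_partial_isometry (alg_O n m) (O_R n m)"
    unfolding power_partial_isometry_def using one_le_numeral by blast
qed

end
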